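(* There exist absolute constants $K,C>0$ such that the following holds. Let $p\in(0,1)$, let $n,d$ be integers with $1\le d\le K\sqrt{np(1-p)/\log[np(1-p)]}$, and let $k_1,\dots,k_{d+1}\in\{0,\dots,n\}$ be an $(\eta,M)$-system (with respect to $p$ and $n$) with $M\le\sqrt{np(1-p)}/(9d)$. Let $f,g$ be real multilinear polynomials in $x_1,\dots,x_n$ of degree $d$ with $\|f\|_{\nu_{k_i}}\le1$ and $\|g\|_{\nu_{k_i}}\le1$ for all $1\le i\le d+1$. If the Lévy–Prokhorov distance between the profiles of $f$ and $g$ with respect to $k_1,\dots,k_{d+1}$ is $\epsilon$, where $0<\epsilon\le1/2$, then the Lévy distance between the distribution of $f$ under $\mu_p$ and the distribution of $g$ under $\mu_p$ is at most $$\left(C\,\frac{d}{p(1-p)}\cdot\frac M\eta\right)^{Cd}\frac1{\sqrt[8]{np(1-p)}}+\left(C\sqrt{\frac{\log(1/\epsilon)}{p(1-p)}}\,\frac M\eta\right)^d\epsilon.$$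
   Context: A polynomial is multilinear if all its monomials are squarefree. For $0\le k\le n$, $\nu_k$ is the uniform probability measure on $\{x\in\{0,1\}^n:\sum_i x_i=k\}$; $\mu_p$ is the product measure on $\{0,1\}^n$ with $\mu_p(x)=p^{\sum x_i}(1-p)^{\sum(1-x_i)}$; $\|f\|_\alpha=\sqrt{\mathbb E_\alpha[f^2]}$. Fix $p\in(0,1)$ and $n$. Integers $0\le k_1,\dots,k_r\le n$ form an $(\eta,M)$-system, where $0<\eta\le1$ and $M\ge1$, if with $\sigma_i=\frac{k_i-np}{\sqrt{np(1-p)}}$ one has $|\sigma_i-\sigma_j|\ge\eta$ for all $i\ne j$ and $|\sigma_i|\le M$ for all $i$. Coupling of the slices: let $\boldsymbol\pi$ be a uniformly random permutation of $\{1,\dots,n\}$, and for $0\le s\le n$ let $\mathbf X(s)\in\{0,1\}^n$ be the point with $\mathbf X(s)_i=1$ if $i\in\boldsymbol\pi(\{1,\dots,s\})$ and $\mathbf X(s)_i=0$ otherwise. The profile of $f$ with respect to $k_1,\dots,k_{d+1}$ is the joint distribution of $(f(\mathbf X(k_1)),\dots,f(\mathbf X(k_{d+1})))$. The Lévy distance between two real random variables $X,Y$ is the infimum of all $\epsilon$ such that for all $t\in\mathbb R$, $\Pr[X\le t-\epsilon]-\epsilon\le\Pr[Y\le t]\le\Pr[X\le t+\epsilon]+\epsilon$. The Lévy–Prokhorov distance between two $r$-dimensional real distributions $X,Y$ is the infimum of all $\epsilon$ such that for all Borel sets $A\subseteq\mathbb R^r$, $\Pr[X\in A]\le\Pr[Y\in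 A^\epsilon]+\epsilon$ and $\Pr[Y\in A]\le\Pr[X\in A^\epsilon]+\epsilon$, where $A^\epsilon$ is the set of points at distance at most $\epsilon$ from $A$ in the $L^\infty$ metric. *)

theory Defs
  imports "HOL-Probability.Probability" "HOL-Library.Poly_Mapping"
begin

section \<open>Multivariate polynomials\<close>

text \<open>
  A real polynomial in the variables \<open>x\<^sub>i\<close> (\<open>i :: nat\<close>) is a finitely supported map from
  monomials to coefficients; a monomial is a finitely supported exponent map.
\<close>

type_synonym monomial = "nat \<Rightarrow>\<^sub>0 nat"
type_synonym rpoly = "monomial \<Rightarrow>\<^sub>0 real"

definition monomial_degree :: "monomial \<Rightarrow> nat" where
  "monomial_degree m = (\<Sum>i\<in>Poly_Mapping.keys m. Poly_Mapping.lookup m i)"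

text \<open>Total degree; the zero polynomial gets degree 0.\<close>

definition rpoly_degree :: "rpoly \<Rightarrow> nat" where
  "rpoly_degree f = Max (insert 0 (monomial_degree ` Poly_Mapping.keys f))"

definition rpoly_eval :: "rpoly \<Rightarrow> (nat \<Rightarrow> real) \<Rightarrow> real" where
  "rpoly_eval f x = (\<Sum>m\<in>Poly_Mapping.keys f. Poly_Mapping.lookup f m *
      (\<Prod>i\<in>Poly_Mapping.keys m. x i ^ Poly_Mapping.lookup m i))"

definition rpoly_in_vars :: "nat set \<Rightarrow> rpoly \<Rightarrow> bool" where
  "rpoly_in_vars I f \<longleftrightarrow> (\<forall>m\<in>Poly_Mapping.keys f. Poly_Mapping.keys m \<subseteq> I)"

definition squarefree_monomial :: "monomial \<Rightarrow> bool" where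
  "squarefree_monomial m \<longleftrightarrow> (\<forall>i. Poly_Mapping.lookup m i \<le> 1)"

definition multilinear :: "rpoly \<Rightarrow> bool" where
  "multilinear f \<longleftrightarrow> (\<forall>m\<in>Poly_Mapping.keys f. squarefree_monomial m)"


section \<open>Measures on the Boolean cube\<close>

text \<open>
  Points of the cube are functions on \<open>{1..n}\<close> with values in \<open>{0, 1}\<close>, extended by 0 to all of
  \<open>nat\<close>.
\<close>

definition cube :: "nat \<Rightarrow> (nat \<Rightarrow> real) set" where
  "cube n = PiE_dflt {1..n} 0 (\<lambda>_. {0, 1})"

definition slice :: "nat \<Rightarrow> nat \<Rightarrow> (nat \<Rightarrow> real) set" where
  "slice n k = {x \<in> cube n. (\<Sum>i=1..n. x i) = real k}"

definition nu :: "nat \<Rightarrow> nat \<Rightarrow> (nat \<Rightarrow> real) pmf" where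
  "nu n k = pmf_of_set (slice n k)"

definition mu :: "nat \<Rightarrow> real \<Rightarrow> (nat \<Rightarrow> real) pmf" where
  "mu n p = Pi_pmf {1..n} 0 (\<lambda>_. map_pmf of_bool (bernoulli_pmf p))"

lemma pmf_mu:
  assumes p: "0 < p" "p < 1" and x: "x \<in> cube n"
  shows "pmf (mu n p) x = p powr (\<Sum>i=1..n. x i) * (1 - p) powr (\<Sum>i=1..n. 1 - x i)"
proof -
  have inj: "inj (of_bool :: bool \<Rightarrow> real)" by (auto simp: inj_def)
  have t: "pmf (map_pmf of_bool (bernoulli_pmf p)) (1::real) = p"
    using pmf_map_inj'[OF inj, of "bernoulli_pmf p" True] p by simp
  have f: "pmf (map_pmf of_bool (bernoulli_pmf p)) (0::real) = 1 - p"
    using pmf_map_inj'[OF inj, of "bernoulli_pmf p" False] p by simp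
  have "pmf (mu n p) x = (\<Prod>i=1..n. pmf (map_pmf of_bool (bernoulli_pmf p)) (x i))"
    using x unfolding mu_def cube_def by (subst pmf_Pi') (auto simp: PiE_dflt_def)
  also have "\<dots> = (\<Prod>i=1..n. p powr (x i) * (1 - p) powr (1 - x i))"
  proof (rule prod.cong[OF refl])
    fix i assume "i \<in> {1..n}"
    then have "x i = 0 \<or> x i = 1" using x unfolding cube_def PiE_dflt_def by auto
    then show "pmf (map_pmf of_bool (bernoulli_pmf p)) (x i) = p powr (x i) * (1 - p) powr (1 - x i)"
      using t f p by auto
  qed
  also have "\<dots> = p powr (\<Sum>i=1..n. x i) * (1 - p) powr (\<Sum>i=1..n. 1 - x i)"
    using p by (simp add: prod.distrib powr_sum)
  finally show ?thesis .
qed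

definition L2_norm_pmf :: "'a pmf \<Rightarrow> ('a \<Rightarrow> real) \<Rightarrow> real" where
  "L2_norm_pmf \<alpha> f = sqrt (measure_pmf.expectation \<alpha> (\<lambda>x. (f x)\<^sup>2))"


section \<open>Systems of slices, coupling and profile\<close>

definition slice_sigma :: "nat \<Rightarrow> real \<Rightarrow> nat \<Rightarrow> real" where
  "slice_sigma n p k = (real k - real n * p) / sqrt (real n * p * (1 - p))"

text \<open>The indices \<open>k\<^sub>1, \<dots>, k\<^sub>r\<close> are the values of \<open>k\<close> on \<open>{1..r}\<close>.\<close>

definition slice_system ::
  "real \<Rightarrow> nat \<Rightarrow> real \<Rightarrow> real \<Rightarrow> nat \<Rightarrow> (nat \<Rightarrow> nat) \<Rightarrow> bool" where
  "slice_system p n \<eta> M r k \<longleftrightarrow>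
     0 < \<eta> \<and> \<eta> \<le> 1 \<and> 1 \<le> M \<and>
     (\<forall>i\<in>{1..r}. k i \<le> n) \<and>
     (\<forall>i\<in>{1..r}. \<forall>j\<in>{1..r}. i \<noteq> j \<longrightarrow>
        \<bar>slice_sigma n p (k i) - slice_sigma n p (k j)\<bar> \<ge> \<eta>) \<and>
     (\<forall>i\<in>{1..r}. \<bar>slice_sigma n p (k i)\<bar> \<le> M)"

definition random_permutation :: "nat \<Rightarrow> (nat \<Rightarrow> nat) pmf" where
  "random_permutation n = pmf_of_set {\<pi>. \<pi> permutes {1..n}}"

definition coupling_point :: "(nat \<Rightarrow> nat) \<Rightarrow> nat \<Rightarrow> (nat \<Rightarrow> real)" where
  "coupling_point \<pi> s = (\<lambda>i. if i \<in> \<pi> ` {1..s} then 1 else 0)"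

text \<open>
  \<open>\<real>\<^sup>r\<close> is the finite product \<open>\<Pi>\<^sub>M j\<in>{1..r}. borel\<close> (extensional functions on \<open>{1..r}\<close>), whose
  \<open>\<sigma>\<close>-algebra is the Borel \<open>\<sigma>\<close>-algebra of \<open>\<real>\<^sup>r\<close>; the dimension depends on a natural number.
\<close>

abbreviation Rn_borel :: "nat \<Rightarrow> (nat \<Rightarrow> real) measure" where
  "Rn_borel r \<equiv> (\<Pi>\<^sub>M j\<in>{1..r}. borel)"

definition profile :: "nat \<Rightarrow> nat \<Rightarrow> (nat \<Rightarrow> nat) \<Rightarrow> rpoly \<Rightarrow> (nat \<Rightarrow> real) measure" where
  "profile n r k f = distr (random_permutation n) (Rn_borel r)
     (\<lambda>\<pi>. \<lambda>j\<in>{1..r}. rpoly_eval f (coupling_point \<pi> (k j)))"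


section \<open>Distances between distributions\<close>

text \<open>
  In both distances no sign condition on \<open>\<epsilon>\<close> is needed: for probability measures (and \<open>r \<ge> 1\<close>)
  a negative \<open>\<epsilon>\<close> never satisfies the condition, while \<open>\<epsilon> = 1\<close> always does.
\<close>

definition levy_dist :: "real measure \<Rightarrow> real measure \<Rightarrow> real" where
  "levy_dist P Q = Inf {\<epsilon>. \<forall>t. cdf P (t - \<epsilon>) - \<epsilon> \<le> cdf Q t \<and> cdf Q t \<le> cdf P (t + \<epsilon>) + \<epsilon>}"

definition Linf_dist :: "nat \<Rightarrow> (nat \<Rightarrow> real) \<Rightarrow> (nat \<Rightarrow> real) \<Rightarrow> real" where
  "Linf_dist r x y = (MAX i\<in>{1..r}. \<bar>x i - y i\<bar>)"

text \<open>The empty set is at infinite distance from every point, so its enlargement is empty.\<close>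

definition Linf_enlarge :: "nat \<Rightarrow> real \<Rightarrow> (nat \<Rightarrow> real) set \<Rightarrow> (nat \<Rightarrow> real) set" where
  "Linf_enlarge r \<epsilon> A =
     {y \<in> space (Rn_borel r). A \<noteq> {} \<and> (INF x\<in>A. Linf_dist r x y) \<le> \<epsilon>}"

definition levy_prokhorov_dist ::
  "nat \<Rightarrow> (nat \<Rightarrow> real) measure \<Rightarrow> (nat \<Rightarrow> real) measure \<Rightarrow> real" where
  "levy_prokhorov_dist r P Q = Inf {\<epsilon>. \<forall>A\<in>sets (Rn_borel r).
      measure P A \<le> measure Q (Linf_enlarge r \<epsilon> A) + \<epsilon> \<and>
      measure Q A \<le> measure P (Linf_enlarge r \<epsilon> A) + \<epsilon>}"

end

theory Submission
  imports Defs
begin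

text \<open>
  Write \<open>X s\<close> for the coupled point on slice \<open>s\<close>, that is, the set \<open>\<pi> ` {1..s}\<close>. Since \<open>\<mu>\<^sub>p\<close> is the
  mixture of the slices with binomial weights, \<open>f\<close> under \<open>\<mu>\<^sub>p\<close> is distributed like \<open>f (X s)\<close> with
  \<open>s\<close> binomial and independent of \<open>\<pi>\<close>. The point is that, for \<open>s\<close> within a few standard
  deviations of \<open>np\<close>, the value \<open>f (X s)\<close> is nearly a fixed linear functional of the profile
  \<open>(f (X k\<^sub>1), \<dots>, f (X k\<^sub>d\<^sub>+\<^sub>1))\<close>, namely its Lagrange interpolation at \<open>s\<close>.

  This holds because of what happens after conditioning on a slightly larger slice \<open>u\<close>.
  Conditionally on \<open>X u\<close>, the set \<open>X s\<close> is a uniform \<open>s\<close>-subset of \<open>X u\<close>, so a monomial over a set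
  of size \<open>t\<close> survives with probability \<open>(s choose t) / (u choose t)\<close>. Hence
  \<open>E[f (X s) | X u]\<close> is exactly a polynomial in \<open>s\<close> of degree at most \<open>d\<close>, and Lagrange
  interpolation through the \<open>d + 1\<close> nodes reproduces it (\<open>shrink_interpolation\<close>). What remains is the
  conditional variance of \<open>f (X s)\<close> given \<open>X u\<close>. It is the loss of squared norm under the averaging
  operator from slice \<open>s\<close> to slice \<open>u\<close>. In one step this operator composed with its adjoint is
  triangular for the filtration by degree, with diagonal entries
  \<open>(1 - e / (u + 1)) (1 - e / (n - u))\<close>, so a function of degree at most \<open>d\<close> keeps at least the
  fraction belonging to \<open>e = d\<close> (\<open>slice_decay\<close>). Over a window of \<open>\<tau> \<surd>V\<close> slices on each side, where
  \<open>V = n p (1 - p)\<close>, the total relative loss is of order \<open>\<tau> d / \<surd>V\<close>. Together these bound the mean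
  square of the interpolation error (\<open>interpolation_error\<close>).

  To compare \<open>f\<close> with \<open>g\<close>, let \<open>L\<close> be the interpolation functional at \<open>s\<close>. The event \<open>L y \<le> t\<close> is a
  half-space, and its enlargement by \<open>e\<close> lies in the half-space at level \<open>t + \<Lambda> e\<close>, where \<open>\<Lambda>\<close> bounds
  the absolute sum of the coefficients of \<open>L\<close>. So closeness of the profiles transfers directly to
  the distribution functions of \<open>f (X s)\<close> and \<open>g (X s)\<close> (\<open>slice_cdf_comparison\<close>).
  Averaging over \<open>s\<close>, with Hoeffding's inequality for the slices outside the window, gives
  \<open>levy_dist_profile_bound\<close>.

  The window width is \<open>\<tau> = M \<surd>(ln (1 / \<epsilon>\<^sub>1) / (p (1 - p)))\<close> with \<open>\<epsilon>\<^sub>1 = max \<epsilon> V\<^sup>-\<^sup>1\<^sup>/\<^sup>4\<close>. Truncating \<open>\<epsilon>\<close> from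
  below keeps the factor \<open>ln (1 / \<epsilon>\<^sub>1)\<close> of order \<open>ln V\<close>, so that its power \<open>d / 2\<close> costs only a factor
  \<open>V\<^sup>1\<^sup>/\<^sup>2\<^sup>4\<close> and a factor absorbed by the constant. Markov's inequality yields an error of order
  \<open>V\<^sup>-\<^sup>1\<^sup>/\<^sup>6\<close>, and \<open>-1/6 + 1/24 = -1/8\<close> is the exponent of the bound.
\<close>

section \<open>Averages over a random permutation\<close>

definition perm_mean :: "nat \<Rightarrow> ((nat \<Rightarrow> nat) \<Rightarrow> real) \<Rightarrow> real" where
  "perm_mean n \<Phi> = (\<Sum>\<pi> | \<pi> permutes {1..n}. \<Phi> \<pi>) / fact n"

lemma perm_mean_add: "perm_mean n (\<lambda>\<pi>. \<Phi> \<pi> + \<Psi> \<pi>) = perm_mean n \<Phi> + perm_mean n \<Psi>"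
  by (simp add: perm_mean_def sum.distrib add_divide_distrib)

lemma perm_mean_diff: "perm_mean n (\<lambda>\<pi>. \<Phi> \<pi> - \<Psi> \<pi>) = perm_mean n \<Phi> - perm_mean n \<Psi>"
  by (simp add: perm_mean_def sum_subtractf diff_divide_distrib)

lemma perm_mean_cmult: "perm_mean n (\<lambda>\<pi>. c * \<Phi> \<pi>) = c * perm_mean n \<Phi>"
  by (simp add: perm_mean_def sum_distrib_left)

lemma perm_mean_sum: "perm_mean n (\<lambda>\<pi>. \<Sum>i\<in>I. \<Phi> i \<pi>) = (\<Sum>i\<in>I. perm_mean n (\<Phi> i))"
  unfolding perm_mean_def by (subst sum.swap) (simp add: sum_divide_distrib)

lemma perm_mean_cong:
  "(\<And>\<pi>. \<pi> permutes {1..n} \<Longrightarrow> \<Phi> \<pi> = \<Psi> \<pi>) \<Longrightarrow> perm_mean n \<Phi> = perm_mean n \<Psi>"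
  unfolding perm_mean_def by (intro arg_cong2[of _ _ _ _ "(/)"] sum.cong) auto

lemma perm_mean_mono:
  "(\<And>\<pi>. \<pi> permutes {1..n} \<Longrightarrow> \<Phi> \<pi> \<le> \<Psi> \<pi>) \<Longrightarrow> perm_mean n \<Phi> \<le> perm_mean n \<Psi>"
  unfolding perm_mean_def by (intro divide_right_mono sum_mono) auto

lemma perm_mean_nonneg: "(\<And>\<pi>. 0 \<le> \<Phi> \<pi>) \<Longrightarrow> 0 \<le> perm_mean n \<Phi>"
  unfolding perm_mean_def by (intro divide_nonneg_nonneg sum_nonneg) auto

lemma perm_mean_compose_transpose:
  assumes "a \<in> {1..n}" "b \<in> {1..n}"
  shows "perm_mean n (\<lambda>\<pi>. \<Phi> (\<pi> \<circ> Transposition.transpose a b)) = perm_mean n \<Phi>"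
  unfolding perm_mean_def
  using sum_permutations_compose_right[OF permutes_swap_id[OF assms], of \<Phi>] by simp

lemma perm_inj_on: "\<pi> permutes S \<Longrightarrow> inj_on \<pi> A"
  using permutes_inj inj_on_subset by blast

lemma card_perm_image: "\<pi> permutes S \<Longrightarrow> card (\<pi> ` A) = card A"
  by (intro card_image perm_inj_on)

lemma perm_image_subset:
  fixes n s :: nat
  assumes "\<pi> permutes {1..n}" "s \<le> n"
  shows "\<pi> ` {1..s} \<subseteq> {1..n}"
proof -
  have "\<pi> ` {1..s} \<subseteq> \<pi> ` {1..n}" using assms(2) by (intro image_mono) auto
  then show ?thesis unfolding permutes_image[OF assms(1)] .
qed

text \<open>
  Composing \<open>\<pi>\<close> with the transposition of \<open>j\<close> and \<open>u + 1\<close>, for \<open>j \<le> u + 1\<close>, keeps the larger prefix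
  and removes \<open>\<pi> j\<close> instead of \<open>\<pi> (u + 1)\<close>; averaging over \<open>j\<close> shows that, given the larger prefix,
  the removed element is uniform in it.
\<close>

lemma perm_mean_step_down:
  assumes "u < n"
  shows "perm_mean n (\<lambda>\<pi>. g (\<pi> ` {1..u}) * h (\<pi> ` {1..Suc u})) =
    perm_mean n (\<lambda>\<pi>. (\<Sum>i\<in>\<pi> ` {1..Suc u}. g (\<pi> ` {1..Suc u} - {i})) / real (Suc u)
      * h (\<pi> ` {1..Suc u}))"
proof -
  let ?L = "perm_mean n (\<lambda>\<pi>. g (\<pi> ` {1..u}) * h (\<pi> ` {1..Suc u}))"
  have one: "perm_mean n (\<lambda>\<pi>. g (\<pi> ` {1..Suc u} - {\<pi> j}) * h (\<pi> ` {1..Suc u})) = ?L"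
    if j: "j \<in> {1..Suc u}" for j
  proof -
    have "?L = perm_mean n (\<lambda>\<pi>. g ((\<pi> \<circ> Transposition.transpose j (Suc u)) ` {1..u}) *
        h ((\<pi> \<circ> Transposition.transpose j (Suc u)) ` {1..Suc u}))"
      by (rule perm_mean_compose_transpose[symmetric]) (use j assms in auto)
    also have "\<dots> = perm_mean n (\<lambda>\<pi>. g (\<pi> ` {1..Suc u} - {\<pi> j}) * h (\<pi> ` {1..Suc u}))"
    proof (rule perm_mean_cong)
      fix \<pi> assume p: "\<pi> permutes {1..n}"
      have a: "Transposition.transpose j (Suc u) ` {1..Suc u} = {1..Suc u}"
        using j by (intro permutes_image permutes_swap_id) auto
      have "Transposition.transpose j (Suc u) ` {1..u} = Transposition.transpose j (Suc u) ` ({1..Suc u} - {Suc u})"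
        by (rule arg_cong2[of _ _ _ _ "(`)"]) auto
      also have "\<dots> = Transposition.transpose j (Suc u) ` {1..Suc u} - Transposition.transpose j (Suc u) ` {Suc u}"
        by (rule image_set_diff) simp
      also have "\<dots> = {1..Suc u} - {j}" by (simp only: a) simp
      finally have "(\<pi> \<circ> Transposition.transpose j (Suc u)) ` {1..u} = \<pi> ` ({1..Suc u} - {j})"
        by (simp only: image_comp[symmetric])
      also have "\<dots> = \<pi> ` {1..Suc u} - {\<pi> j}"
        using image_set_diff[OF permutes_inj[OF p], of "{1..Suc u}" "{j}"] by simp
      finally show "g ((\<pi> \<circ> Transposition.transpose j (Suc u)) ` {1..u}) *
          h ((\<pi> \<circ> Transposition.transpose j (Suc u)) ` {1..Suc u}) =
          g (\<pi> ` {1..Suc u} - {\<pi> j}) * h (\<pi> ` {1..Suc u})"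
        using a by (simp only: image_comp[symmetric])
    qed
    finally show ?thesis by simp
  qed
  have "real (Suc u) * ?L = (\<Sum>j\<in>{1..Suc u}. ?L)" by simp
  also have "\<dots> = (\<Sum>j\<in>{1..Suc u}.
      perm_mean n (\<lambda>\<pi>. g (\<pi> ` {1..Suc u} - {\<pi> j}) * h (\<pi> ` {1..Suc u})))"
    using one by (intro sum.cong) auto
  also have "\<dots> = perm_mean n (\<lambda>\<pi>. \<Sum>j\<in>{1..Suc u}.
      g (\<pi> ` {1..Suc u} - {\<pi> j}) * h (\<pi> ` {1..Suc u}))"
    by (rule perm_mean_sum[symmetric])
  also have "\<dots> = perm_mean n (\<lambda>\<pi>. real (Suc u) *
      ((\<Sum>i\<in>\<pi> ` {1..Suc u}. g (\<pi> ` {1..Suc u} - {i})) / real (Suc u) * h (\<pi> ` {1..Suc u})))"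
  proof (rule perm_mean_cong)
    fix \<pi> assume p: "\<pi> permutes {1..n}"
    show "(\<Sum>j\<in>{1..Suc u}. g (\<pi> ` {1..Suc u} - {\<pi> j}) * h (\<pi> ` {1..Suc u})) =
      real (Suc u) *
      ((\<Sum>i\<in>\<pi> ` {1..Suc u}. g (\<pi> ` {1..Suc u} - {i})) / real (Suc u) * h (\<pi> ` {1..Suc u}))"
      by (subst sum.reindex[OF perm_inj_on[OF p]])
        (simp add: sum_distrib_right[symmetric] del: of_nat_Suc sum.cl_ivl_Suc)
  qed
  finally show ?thesis
    unfolding perm_mean_cmult by (rule mult_left_cancel[THEN iffD1, rotated]) simp
qed

text \<open>
  The dual symmetry uses the transpositions of \<open>u + 1\<close> with \<open>j > u\<close>. These fix all prefixes up to \<open>u\<close>,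
  so the factor \<open>g\<close> may depend on any earlier prefix. This freedom expresses the Markov property of
  the coupling and is what makes the induction in \<open>perm_mean_shrink\<close> work.
\<close>

lemma perm_mean_step_up:
  assumes "s \<le> u" "u < n"
  shows "perm_mean n (\<lambda>\<pi>. g (\<pi> ` {1..s}) * h (\<pi> ` {1..Suc u})) =
    perm_mean n (\<lambda>\<pi>. g (\<pi> ` {1..s}) *
      ((\<Sum>i\<in>{1..n} - \<pi> ` {1..u}. h (insert i (\<pi> ` {1..u}))) / real (n - u)))"
proof -
  let ?L = "perm_mean n (\<lambda>\<pi>. g (\<pi> ` {1..s}) * h (\<pi> ` {1..Suc u}))"
  have one: "perm_mean n (\<lambda>\<pi>. g (\<pi> ` {1..s}) * h (insert (\<pi> j) (\<pi> ` {1..u}))) = ?L"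
    if j: "j \<in> {Suc u..n}" for j
  proof -
    have "?L = perm_mean n (\<lambda>\<pi>. g ((\<pi> \<circ> Transposition.transpose j (Suc u)) ` {1..s}) *
        h ((\<pi> \<circ> Transposition.transpose j (Suc u)) ` {1..Suc u}))"
      by (rule perm_mean_compose_transpose[symmetric]) (use j assms in auto)
    also have "\<dots> = perm_mean n (\<lambda>\<pi>. g (\<pi> ` {1..s}) * h (insert (\<pi> j) (\<pi> ` {1..u})))"
    proof -
      have fixed: "Transposition.transpose j (Suc u) ` {1..w} = {1..w}" if "w \<le> u" for w
        using j that by (force simp: Transposition.transpose_def image_iff)
      have "Transposition.transpose j (Suc u) ` {1..Suc u} = insert j {1..u}"
        using fixed[of u] by (simp add: atLeastAtMostSuc_conv)
      then show ?thesis
        using fixed[of s] assms by (simp only: image_comp[symmetric] image_insert)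
    qed
    finally show ?thesis by simp
  qed
  have "real (n - u) * ?L = (\<Sum>j\<in>{Suc u..n}. ?L)" by simp
  also have "\<dots> = (\<Sum>j\<in>{Suc u..n}.
      perm_mean n (\<lambda>\<pi>. g (\<pi> ` {1..s}) * h (insert (\<pi> j) (\<pi> ` {1..u}))))"
    using one by (intro sum.cong) auto
  also have "\<dots> = perm_mean n (\<lambda>\<pi>. \<Sum>j\<in>{Suc u..n}.
      g (\<pi> ` {1..s}) * h (insert (\<pi> j) (\<pi> ` {1..u})))"
    by (rule perm_mean_sum[symmetric])
  also have "\<dots> = perm_mean n (\<lambda>\<pi>. real (n - u) * (g (\<pi> ` {1..s}) *
      ((\<Sum>i\<in>{1..n} - \<pi> ` {1..u}. h (insert i (\<pi> ` {1..u}))) / real (n - u))))"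
  proof (rule perm_mean_cong)
    fix \<pi> assume p: "\<pi> permutes {1..n}"
    have "{1..n} - \<pi> ` {1..u} = \<pi> ` {1..n} - \<pi> ` {1..u}" by (simp only: permutes_image[OF p])
    also have "\<dots> = \<pi> ` ({1..n} - {1..u})"
      by (rule image_set_diff[symmetric, OF permutes_inj[OF p]])
    also have "{1..n} - {1..u} = {Suc u..n}" using assms by auto
    finally have e: "{1..n} - \<pi> ` {1..u} = \<pi> ` {Suc u..n}" .
    show "(\<Sum>j\<in>{Suc u..n}. g (\<pi> ` {1..s}) * h (insert (\<pi> j) (\<pi> ` {1..u}))) =
      real (n - u) * (g (\<pi> ` {1..s}) *
      ((\<Sum>i\<in>{1..n} - \<pi> ` {1..u}. h (insert i (\<pi> ` {1..u}))) / real (n - u)))"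
      unfolding e using assms
      by (subst sum.reindex[OF perm_inj_on[OF p]]) (simp add: sum_distrib_left[symmetric])
  qed
  finally show ?thesis
    unfolding perm_mean_cmult by (rule mult_left_cancel[THEN iffD1, rotated]) (use assms in simp)
qed

section \<open>Multilinear functions and the one-step operators\<close>

text \<open>
  A multilinear polynomial, identified with its coefficients, evaluated at the indicator of \<open>A\<close>.
\<close>

definition multilin :: "(nat set \<Rightarrow> real) \<Rightarrow> nat set \<Rightarrow> real" where
  "multilin c A = (\<Sum>T\<in>Pow A. c T)"

definition degree_le :: "nat \<Rightarrow> (nat set \<Rightarrow> real) \<Rightarrow> bool" where
  "degree_le e c \<longleftrightarrow> (\<forall>T. card T > e \<longrightarrow> c T = 0)"

text \<open>
  The coefficients of the average of the polynomial over the removal of one element from a set of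
  size \<open>u + 1\<close> (see \<open>multilin_remove_mean\<close>).
\<close>

definition down_coeff :: "nat \<Rightarrow> (nat set \<Rightarrow> real) \<Rightarrow> nat set \<Rightarrow> real" where
  "down_coeff u c T = (1 - real (card T) / real (Suc u)) * c T"

text \<open>
  The coefficients of the average of the polynomial over the insertion of one new element of
  \<open>{1..n}\<close> into a set of size \<open>u\<close> (see \<open>multilin_insert_mean\<close>).
\<close>

definition up_coeff :: "nat \<Rightarrow> nat \<Rightarrow> (nat set \<Rightarrow> real) \<Rightarrow> nat set \<Rightarrow> real" where
  "up_coeff n u c T =
     (1 - real (card T) / real (n - u)) * c T
     + (\<Sum>i\<in>{1..n} - T. c (insert i T)) / real (n - u)"

lemma multilin_add: "multilin (\<lambda>T. c T + b T) A = multilin c A + multilin b A"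
  by (simp add: multilin_def sum.distrib)

lemma multilin_diff: "multilin (\<lambda>T. c T - b T) A = multilin c A - multilin b A"
  by (simp add: multilin_def sum_subtractf)

lemma multilin_cmult: "multilin (\<lambda>T. x * c T) A = x * multilin c A"
  by (simp add: multilin_def sum_distrib_left)

text \<open>
  A monomial over \<open>T\<close> survives the removal of \<open>i\<close> exactly if \<open>i \<notin> T\<close>.
\<close>

lemma multilin_remove_mean:
  assumes "card A = Suc u"
  shows "(\<Sum>i\<in>A. multilin c (A - {i})) / real (Suc u) = multilin (down_coeff u c) A"
proof -
  have fin: "finite A" using assms by (metis card.infinite nat.distinct(1))
  have "(\<Sum>i\<in>A. multilin c (A - {i})) = (\<Sum>i\<in>A. \<Sum>T\<in>Pow A. if i \<in> T then 0 else c T)"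
    unfolding multilin_def using fin
    by (intro sum.cong refl sum.mono_neutral_cong_left) auto
  also have "\<dots> = (\<Sum>T\<in>Pow A. \<Sum>i\<in>A. if i \<in> T then 0 else c T)"
    by (rule sum.swap)
  also have "\<dots> = (\<Sum>T\<in>Pow A. real (card A - card T) * c T)"
  proof (rule sum.cong[OF refl])
    fix T assume T: "T \<in> Pow A"
    have "(\<Sum>i\<in>A. if i \<in> T then 0 else c T) = (\<Sum>i\<in>A - T. c T)"
      using fin by (intro sum.mono_neutral_cong_right) auto
    also have "\<dots> = real (card A - card T) * c T"
      using T fin by (simp add: card_Diff_subset finite_subset)
    finally show "(\<Sum>i\<in>A. if i \<in> T then 0 else c T) = real (card A - card T) * c T" .
  qed
  also have "\<dots> = (\<Sum>T\<in>Pow A. real (Suc u) * down_coeff u c T)"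
  proof (rule sum.cong[OF refl])
    fix T assume T: "T \<in> Pow A"
    have "card T \<le> Suc u" using T fin assms card_mono by fastforce
    then show "real (card A - card T) * c T = real (Suc u) * down_coeff u c T"
      by (simp add: down_coeff_def assms field_simps of_nat_diff)
  qed
  finally show ?thesis
    by (simp add: multilin_def sum_distrib_left[symmetric] del: of_nat_Suc)
qed

lemma multilin_insert:
  assumes "finite A" "i \<notin> A"
  shows "multilin c (insert i A) = multilin c A + (\<Sum>T\<in>Pow A. c (insert i T))"
proof -
  have "inj_on (insert i) (Pow A)" using assms by (auto simp: inj_on_def)
  moreover have "Pow A \<inter> insert i ` Pow A = {}" using assms by auto
  ultimately show ?thesis
    using assms by (simp add: multilin_def Pow_insert sum.union_disjoint sum.reindex)
qed

text \<open>
  Double counting: a set \<open>T\<close> arises as \<open>insert i T'\<close> with \<open>i \<notin> T'\<close> once for each of its elements.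
\<close>

lemma sum_insert_card:
  assumes "finite A"
  shows "(\<Sum>T\<in>Pow A. \<Sum>i\<in>A - T. c (insert i T)) = (\<Sum>T\<in>Pow A. real (card T) * c T)"
proof -
  have "(\<Sum>T\<in>Pow A. \<Sum>i\<in>A - T. c (insert i T)) =
      (\<Sum>(T, i)\<in>Sigma (Pow A) (\<lambda>T. A - T). c (insert i T))"
    using assms by (intro sum.Sigma) auto
  also have "\<dots> = (\<Sum>(T, i)\<in>Sigma (Pow A) (\<lambda>T. T). c T)"
    by (rule sum.reindex_bij_witness[where i = "\<lambda>(T, i). (T - {i}, i)" and j = "\<lambda>(T, i). (insert i T, i)"])
      (auto simp: insert_absorb)
  also have "\<dots> = (\<Sum>T\<in>Pow A. \<Sum>i\<in>T. c T)"
    using assms by (intro sum.Sigma[symmetric]) (auto intro: finite_subset)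
  finally show ?thesis by simp
qed

text \<open>
  The sum over new elements \<open>i \<notin> A\<close> is the sum over all \<open>i \<notin> T\<close>, which depends on \<open>T\<close> only, minus the
  sum over \<open>i \<in> A - T\<close>, which is computed by \<open>sum_insert_card\<close>. So the average is again multilinear,
  with coefficients that do not depend on \<open>A\<close>.
\<close>

lemma multilin_insert_mean:
  assumes "A \<subseteq> {1..n}" "card A = u" "u < n"
  shows "(\<Sum>i\<in>{1..n} - A. multilin c (insert i A)) / real (n - u) = multilin (up_coeff n u c) A"
proof -
  have fin: "finite A" using assms finite_subset by blast
  have card: "card ({1..n} - A) = n - u" using assms fin by (simp add: card_Diff_subset)
  have "(\<Sum>i\<in>{1..n} - A. multilin c (insert i A)) =
      (\<Sum>i\<in>{1..n} - A. multilin c A + (\<Sum>T\<in>Pow A. c (insert i T)))"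
    using fin by (intro sum.cong refl multilin_insert) auto
  also have "\<dots> = real (n - u) * multilin c A + (\<Sum>T\<in>Pow A. \<Sum>i\<in>{1..n} - A. c (insert i T))"
    by (simp add: sum.distrib card[simplified] sum.swap[of _ "Pow A"])
  also have "(\<Sum>T\<in>Pow A. \<Sum>i\<in>{1..n} - A. c (insert i T)) =
      (\<Sum>T\<in>Pow A. (\<Sum>i\<in>{1..n} - T. c (insert i T)) - (\<Sum>i\<in>A - T. c (insert i T)))"
  proof (rule sum.cong[OF refl])
    fix T assume "T \<in> Pow A"
    then have "{1..n} - T = ({1..n} - A) \<union> (A - T)" using assms by auto
    moreover have "({1..n} - A) \<inter> (A - T) = {}" by auto
    ultimately show "(\<Sum>i\<in>{1..n} - A. c (insert i T)) =
        (\<Sum>i\<in>{1..n} - T. c (insert i T)) - (\<Sum>i\<in>A - T. c (insert i T))"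
      using fin by (simp add: sum.union_disjoint)
  qed
  also have "\<dots> = (\<Sum>T\<in>Pow A. \<Sum>i\<in>{1..n} - T. c (insert i T)) - (\<Sum>T\<in>Pow A. real (card T) * c T)"
    by (simp add: sum_subtractf sum_insert_card[OF fin])
  finally have "(\<Sum>i\<in>{1..n} - A. multilin c (insert i A)) =
      (\<Sum>T\<in>Pow A. real (n - u) * c T + ((\<Sum>i\<in>{1..n} - T. c (insert i T)) - real (card T) * c T))"
    by (simp add: multilin_def sum.distrib sum_subtractf sum_distrib_left)
  also have "\<dots> = (\<Sum>T\<in>Pow A. real (n - u) * up_coeff n u c T)"
  proof (rule sum.cong[OF refl])
    fix T
    have "N * c T + (y - real (card T) * c T) = N * ((1 - real (card T) / N) * c T + y / N)"
      if "N \<noteq> 0" for N y :: real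
      using that by (simp add: field_simps)
    then show "real (n - u) * c T + ((\<Sum>i\<in>{1..n} - T. c (insert i T)) - real (card T) * c T) =
        real (n - u) * up_coeff n u c T"
      unfolding up_coeff_def using assms by simp
  qed
  also have "\<dots> = real (n - u) * multilin (up_coeff n u c) A"
    by (simp add: multilin_def sum_distrib_left[symmetric])
  finally show ?thesis using assms by simp
qed

section \<open>Norm loss of functions of low degree\<close>

definition slice_inner :: "nat \<Rightarrow> nat \<Rightarrow> (nat set \<Rightarrow> real) \<Rightarrow> (nat set \<Rightarrow> real) \<Rightarrow> real" where
  "slice_inner n s c b = perm_mean n (\<lambda>\<pi>. multilin c (\<pi> ` {1..s}) * multilin b (\<pi> ` {1..s}))"

lemma slice_inner_commute: "slice_inner n s c b = slice_inner n s b c"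
  by (simp add: slice_inner_def mult.commute)

lemma slice_inner_add: "slice_inner n s (\<lambda>T. c T + b T) a = slice_inner n s c a + slice_inner n s b a"
  by (simp add: slice_inner_def multilin_add distrib_right perm_mean_add)

lemma slice_inner_cmult: "slice_inner n s (\<lambda>T. x * c T) a = x * slice_inner n s c a"
  by (simp add: slice_inner_def multilin_cmult mult.assoc perm_mean_cmult)

lemma slice_inner_add_right: "slice_inner n s a (\<lambda>T. c T + b T) = slice_inner n s a c + slice_inner n s a b"
  using slice_inner_add slice_inner_commute by metis

lemma slice_inner_nonneg: "0 \<le> slice_inner n s c c"
  unfolding slice_inner_def by (intro perm_mean_nonneg) simp

lemma perm_mean_down:
  assumes "u < n"
  shows "perm_mean n (\<lambda>\<pi>. multilin c (\<pi> ` {1..u}) * h (\<pi> ` {1..Suc u})) =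
    perm_mean n (\<lambda>\<pi>. multilin (down_coeff u c) (\<pi> ` {1..Suc u}) * h (\<pi> ` {1..Suc u}))"
  unfolding perm_mean_step_down[OF assms, of "multilin c"]
  by (intro perm_mean_cong, subst multilin_remove_mean) (auto simp: card_perm_image)

text \<open>
  Both sides are the average of \<open>multilin c\<close> on one slice times \<open>multilin b\<close> on the next: the two
  one-step operators are adjoint to each other.
\<close>

lemma slice_inner_down_up:
  assumes "u < n"
  shows "slice_inner n (Suc u) (down_coeff u c) b = slice_inner n u c (up_coeff n u b)"
proof -
  have "slice_inner n (Suc u) (down_coeff u c) b =
      perm_mean n (\<lambda>\<pi>. multilin c (\<pi> ` {1..u}) * multilin b (\<pi> ` {1..Suc u}))"
    by (simp only: slice_inner_def perm_mean_down[OF assms])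
  also have "\<dots> = slice_inner n u c (up_coeff n u b)"
    unfolding perm_mean_step_up[OF order_refl assms, of "multilin c"] slice_inner_def
  proof (rule perm_mean_cong)
    fix \<pi> assume p: "\<pi> permutes {1..n}"
    show "multilin c (\<pi> ` {1..u}) *
        ((\<Sum>i\<in>{1..n} - \<pi> ` {1..u}. multilin b (insert i (\<pi> ` {1..u}))) / real (n - u)) =
        multilin c (\<pi> ` {1..u}) * multilin (up_coeff n u b) (\<pi> ` {1..u})"
      using perm_image_subset[OF p, of u] card_perm_image[OF p, of "{1..u}"] assms
      by (subst multilin_insert_mean) auto
  qed
  finally show ?thesis .
qed

text \<open>
  Gram-Schmidt, one vector at a time. If the new vector depends linearly on the earlier ones, its
  residual \<open>r\<close> vanishes and the quotient \<open>t\<close> is a division by zero, hence \<open>0\<close>; any value would do.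
\<close>

lemma orthogonal_projection_finite:
  fixes v :: "'i \<Rightarrow> 'w \<Rightarrow> real"
  assumes "finite I" "finite \<Omega>"
  shows "\<exists>b. \<forall>j\<in>I. (\<Sum>\<omega>\<in>\<Omega>. (f \<omega> - (\<Sum>i\<in>I. b i * v i \<omega>)) * v j \<omega>) = 0"
  using assms(1)
proof (induction I arbitrary: f rule: finite_induct)
  case empty
  then show ?case by simp
next
  case (insert k I)
  obtain a where a: "\<And>j. j \<in> I \<Longrightarrow> (\<Sum>\<omega>\<in>\<Omega>. (v k \<omega> - (\<Sum>i\<in>I. a i * v i \<omega>)) * v j \<omega>) = 0"
    using insert.IH[of "v k"] by blast
  obtain b where b: "\<And>j. j \<in> I \<Longrightarrow> (\<Sum>\<omega>\<in>\<Omega>. (f \<omega> - (\<Sum>i\<in>I. b i * v i \<omega>)) * v j \<omega>) = 0"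
    using insert.IH[of f] by blast
  define r where "r \<omega> = v k \<omega> - (\<Sum>i\<in>I. a i * v i \<omega>)" for \<omega>
  define g where "g \<omega> = f \<omega> - (\<Sum>i\<in>I. b i * v i \<omega>)" for \<omega>
  define t where "t = (\<Sum>\<omega>\<in>\<Omega>. g \<omega> * r \<omega>) / (\<Sum>\<omega>\<in>\<Omega>. r \<omega> * r \<omega>)"
  have tr: "(\<Sum>\<omega>\<in>\<Omega>. (g \<omega> - t * r \<omega>) * r \<omega>) = 0"
  proof (cases "(\<Sum>\<omega>\<in>\<Omega>. r \<omega> * r \<omega>) = 0")
    case True
    then have "\<forall>\<omega>\<in>\<Omega>. r \<omega> = 0" using assms by (simp add: sum_nonneg_eq_0_iff)
    then show ?thesis by simp
  next
    case False
    have "(\<Sum>\<omega>\<in>\<Omega>. (g \<omega> - t * r \<omega>) * r \<omega>) = (\<Sum>\<omega>\<in>\<Omega>. g \<omega> * r \<omega>) - t * (\<Sum>\<omega>\<in>\<Omega>. r \<omega> * r \<omega>)"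
      by (simp add: left_diff_distrib sum_subtractf sum_distrib_left mult.assoc)
    then show ?thesis using False by (simp add: t_def)
  qed
  have orth: "(\<Sum>\<omega>\<in>\<Omega>. (g \<omega> - t * r \<omega>) * v j \<omega>) = 0" if "j \<in> I" for j
  proof -
    have "(\<Sum>\<omega>\<in>\<Omega>. (g \<omega> - t * r \<omega>) * v j \<omega>) =
        (\<Sum>\<omega>\<in>\<Omega>. g \<omega> * v j \<omega>) - t * (\<Sum>\<omega>\<in>\<Omega>. r \<omega> * v j \<omega>)"
      by (simp add: left_diff_distrib sum_subtractf sum_distrib_left mult.assoc)
    then show ?thesis using a[OF that] b[OF that] by (simp add: r_def g_def)
  qed
  define b' where "b' i = (if i = k then t else b i - t * a i)" for i
  have eq: "f \<omega> - (\<Sum>i\<in>insert k I. b' i * v i \<omega>) = g \<omega> - t * r \<omega>" for \<omega>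
  proof -
    have "(\<Sum>i\<in>I. b' i * v i \<omega>) = (\<Sum>i\<in>I. (b i - t * a i) * v i \<omega>)"
      using insert.hyps by (intro sum.cong) (auto simp: b'_def)
    also have "\<dots> = (\<Sum>i\<in>I. b i * v i \<omega>) - t * (\<Sum>i\<in>I. a i * v i \<omega>)"
      by (simp add: left_diff_distrib sum_subtractf sum_distrib_left mult.assoc)
    finally show ?thesis
      using insert.hyps by (simp add: g_def r_def b'_def algebra_simps)
  qed
  have "(\<Sum>\<omega>\<in>\<Omega>. (g \<omega> - t * r \<omega>) * v k \<omega>) = 0"
  proof -
    have "(\<Sum>\<omega>\<in>\<Omega>. (g \<omega> - t * r \<omega>) * v k \<omega>) =
        (\<Sum>\<omega>\<in>\<Omega>. (g \<omega> - t * r \<omega>) * r \<omega> + (\<Sum>i\<in>I. a i * ((g \<omega> - t * r \<omega>) * v i \<omega>)))"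
    proof (rule sum.cong[OF refl])
      fix \<omega>
      have "(\<Sum>i\<in>I. a i * ((g \<omega> - t * r \<omega>) * v i \<omega>)) =
          (g \<omega> - t * r \<omega>) * (\<Sum>i\<in>I. a i * v i \<omega>)"
        by (simp add: sum_distrib_left mult_ac)
      then show "(g \<omega> - t * r \<omega>) * v k \<omega> =
          (g \<omega> - t * r \<omega>) * r \<omega> + (\<Sum>i\<in>I. a i * ((g \<omega> - t * r \<omega>) * v i \<omega>))"
        by (simp add: r_def algebra_simps)
    qed
    also have "\<dots> = (\<Sum>i\<in>I. a i * (\<Sum>\<omega>\<in>\<Omega>. (g \<omega> - t * r \<omega>) * v i \<omega>))"
      by (simp add: sum.distrib tr sum.swap[of _ I \<Omega>] sum_distrib_left)
    also have "\<dots> = 0" using orth by simp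
    finally show ?thesis .
  qed
  then show ?case using orth eq by (intro exI[of _ b']) auto
qed

text \<open>
  On a slice the functions of degree at most \<open>e\<close> are spanned by finitely many monomials.
\<close>

lemma degree_le_projection:
  assumes "s \<le> n"
  obtains b where "degree_le e b"
    "\<And>a. degree_le e a \<Longrightarrow> slice_inner n s (\<lambda>T. c T - b T) a = 0"
proof -
  let ?I = "{T \<in> Pow {1..n}. card T \<le> e}"
  let ?v = "\<lambda>T \<pi>. of_bool (T \<subseteq> \<pi> ` {1..s}) :: real"
  have rep: "multilin a (\<pi> ` {1..s}) = (\<Sum>T\<in>?I. a T * ?v T \<pi>)"
    if "degree_le e a" "\<pi> permutes {1..n}" for a \<pi>
    unfolding multilin_def using that perm_image_subset[OF that(2) assms]
    by (intro sum.mono_neutral_cong) (auto simp: degree_le_def not_le)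
  obtain b where b: "\<And>T. T \<in> ?I \<Longrightarrow>
      (\<Sum>\<pi> | \<pi> permutes {1..n}. (multilin c (\<pi> ` {1..s}) - (\<Sum>T\<in>?I. b T * ?v T \<pi>)) * ?v T \<pi>) = 0"
    using orthogonal_projection_finite[of ?I "{\<pi>. \<pi> permutes {1..n}}" "\<lambda>\<pi>. multilin c (\<pi> ` {1..s})" ?v]
    by (auto simp: finite_permutations)
  define b' where "b' T = (if card T \<le> e then b T else 0)" for T
  have db: "degree_le e b'" by (simp add: degree_le_def b'_def)
  have rb: "multilin b' (\<pi> ` {1..s}) = (\<Sum>T\<in>?I. b T * ?v T \<pi>)" if "\<pi> permutes {1..n}" for \<pi>
    unfolding rep[OF db that] by (intro sum.cong) (auto simp: b'_def)
  have "slice_inner n s (\<lambda>T. c T - b' T) a = 0" if a: "degree_le e a" for a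
  proof -
    have dist: "x * (\<Sum>T\<in>?I. a T * w T) = (\<Sum>T\<in>?I. a T * (x * w T))" for x :: real and w
      by (simp add: sum_distrib_left mult_ac)
    have "slice_inner n s (\<lambda>T. c T - b' T) a = perm_mean n (\<lambda>\<pi>. \<Sum>T\<in>?I. a T *
        ((multilin c (\<pi> ` {1..s}) - (\<Sum>T\<in>?I. b T * ?v T \<pi>)) * ?v T \<pi>))"
      unfolding slice_inner_def multilin_diff
      by (intro perm_mean_cong) (simp only: rb rep[OF a] dist)
    also have "\<dots> = (\<Sum>T\<in>?I. a T * perm_mean n (\<lambda>\<pi>.
        (multilin c (\<pi> ` {1..s}) - (\<Sum>T\<in>?I. b T * ?v T \<pi>)) * ?v T \<pi>))"
      by (simp only: perm_mean_sum perm_mean_cmult)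
    also have "\<dots> = 0"
    proof (rule sum.neutral, rule ballI)
      fix T assume T: "T \<in> ?I"
      show "a T * perm_mean n (\<lambda>\<pi>.
          (multilin c (\<pi> ` {1..s}) - (\<Sum>T\<in>?I. b T * ?v T \<pi>)) * ?v T \<pi>) = 0"
        unfolding perm_mean_def b[OF T] by simp
    qed
    finally show ?thesis .
  qed
  then show ?thesis using db that by blast
qed

text \<open>
  The diagonal entry in degree \<open>e\<close> of the operator that goes from slice \<open>u\<close> to slice \<open>u + 1\<close> and back.
\<close>

definition decay :: "nat \<Rightarrow> nat \<Rightarrow> nat \<Rightarrow> real" where
  "decay n u e = (1 - real e / real (Suc u)) * (1 - real e / real (n - u))"

text \<open>
  In the top degree the terms \<open>c (insert i T)\<close> of the up operator have degree too large to occur, so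
  only the two diagonal factors remain.
\<close>

lemma up_down_triangular:
  assumes "degree_le (Suc e) c"
  shows "degree_le e (\<lambda>T. up_coeff n u (down_coeff u c) T - decay n u (Suc e) * c T)"
  unfolding degree_le_def
proof (intro allI impI)
  fix T :: "nat set" assume T: "card T > e"
  have fin: "finite T" using T card.infinite by fastforce
  have "c (insert i T) = 0" if "i \<notin> T" for i
    using assms T fin that by (auto simp: degree_le_def)
  then have z: "(\<Sum>i\<in>{1..n} - T. down_coeff u c (insert i T)) = 0"
    by (intro sum.neutral) (auto simp: down_coeff_def)
  have "c T = 0 \<or> card T = Suc e" using assms T by (auto simp: degree_le_def)
  then show "up_coeff n u (down_coeff u c) T - decay n u (Suc e) * c T = 0"
    unfolding up_coeff_def z by (auto simp: down_coeff_def decay_def)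
qed

lemma up_down_degree_le: "degree_le e c \<Longrightarrow> degree_le e (up_coeff n u (down_coeff u c))"
  unfolding degree_le_def
proof (intro allI impI)
  fix T :: "nat set" assume c: "\<forall>T. e < card T \<longrightarrow> c T = 0" and T: "card T > e"
  have fin: "finite T" using T card.infinite by fastforce
  have "c (insert i T) = 0" if "i \<notin> T" for i
    using c T fin that by auto
  then have z: "(\<Sum>i\<in>{1..n} - T. down_coeff u c (insert i T)) = 0"
    by (intro sum.neutral) (auto simp: down_coeff_def)
  show "up_coeff n u (down_coeff u c) T = 0"
    unfolding up_coeff_def z using c T by (simp add: down_coeff_def)
qed

lemma decay_antimono:
  assumes "e \<le> e'" "e' \<le> Suc u" "e' \<le> n - u"
  shows "decay n u e' \<le> decay n u e"
  unfolding decay_def using assms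
  by (intro mult_mono diff_left_mono divide_right_mono) (auto simp: divide_simps)

text \<open>
  The composite of the down and up operators preserves the degree filtration and is self-adjoint,
  so it also preserves the part of degree \<open>e + 1\<close> orthogonal to the functions of degree at most \<open>e\<close>.
  By triangularity it acts on that part as the scalar \<open>decay n u (e + 1)\<close>. The scalars decrease with
  the degree, so the smallest one bounds the whole quadratic form from below.
\<close>

lemma slice_decay:
  assumes "u < n" "degree_le e c" "e \<le> Suc u" "e \<le> n - u"
  shows "slice_inner n (Suc u) (down_coeff u c) (down_coeff u c) \<ge> decay n u e * slice_inner n u c c"
  using assms(2-4)
proof (induction e arbitrary: c)
  case 0
  have "c T = 0" if "card T > 0" for T
    using 0(1) that by (simp add: degree_le_def)
  then have "down_coeff u c T = c T" for T
    by (cases "card T > 0") (auto simp: down_coeff_def)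
  then have d: "down_coeff u c = c" by auto
  have const: "multilin c A = c {}" if "finite A" for A
  proof -
    have "\<forall>T\<in>Pow A - {{}}. c T = 0"
    proof
      fix T assume "T \<in> Pow A - {{}}"
      then have "card T > 0" using that finite_subset[of T A] by (simp add: card_gt_0_iff)
      then show "c T = 0" using 0(1) by (simp add: degree_le_def)
    qed
    then have "multilin c A = (\<Sum>T\<in>{{}}. c T)" unfolding multilin_def using that
      by (intro sum.mono_neutral_right) auto
    then show ?thesis by simp
  qed
  show ?case unfolding d slice_inner_def decay_def by (simp add: const)
next
  case (Suc e)
  let ?D = "down_coeff u" and ?U = "up_coeff n u"
  obtain b where b: "degree_le e b"
    and orth: "\<And>a. degree_le e a \<Longrightarrow> slice_inner n u (\<lambda>T. c T - b T) a = 0"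
    using degree_le_projection[of u n e c] assms(1) by auto
  define h where "h T = c T - b T" for T
  have orth: "slice_inner n u h a = 0" if "degree_le e a" for a
    using orth[OF that] by (simp add: h_def[abs_def])
  have split: "c = (\<lambda>T. b T + h T)" by (simp add: h_def)
  have dh: "degree_le (Suc e) h"
    using Suc.prems(1) b by (auto simp: degree_le_def h_def)
  have Dsplit: "?D c = (\<lambda>T. ?D b T + ?D h T)"
    by (subst split) (simp add: down_coeff_def fun_eq_iff distrib_left)
  \<comment> \<open>Going down and back up maps \<open>b\<close> into degree at most \<open>e\<close>, which is orthogonal to \<open>h\<close>.\<close>
  have cross: "slice_inner n (Suc u) (?D h) (?D b) = 0"
    unfolding slice_inner_down_up[OF assms(1)] by (intro orth up_down_degree_le b)
  have top: "slice_inner n (Suc u) (?D h) (?D h) = decay n u (Suc e) * slice_inner n u h h"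
  proof -
    let ?r = "\<lambda>T. ?U (?D h) T - decay n u (Suc e) * h T"
    have "?U (?D h) = (\<lambda>T. decay n u (Suc e) * h T + ?r T)" by auto
    then have "slice_inner n u h (?U (?D h)) =
        slice_inner n u h (\<lambda>T. decay n u (Suc e) * h T) + slice_inner n u h ?r"
      using slice_inner_add_right by metis
    also have "slice_inner n u h ?r = 0" by (intro orth up_down_triangular dh)
    also have "slice_inner n u h (\<lambda>T. decay n u (Suc e) * h T) = decay n u (Suc e) * slice_inner n u h h"
      using slice_inner_cmult slice_inner_commute by metis
    finally show ?thesis unfolding slice_inner_down_up[OF assms(1)] by simp
  qed
  have "slice_inner n u c c = slice_inner n u b b + slice_inner n u h h"
    using orth[OF b] slice_inner_commute[of n u h b]
    by (subst (1 2) split) (simp add: slice_inner_add slice_inner_add_right)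
  then have "decay n u (Suc e) * slice_inner n u c c =
      decay n u (Suc e) * slice_inner n u b b + decay n u (Suc e) * slice_inner n u h h"
    by (simp add: distrib_left)
  also have "\<dots> \<le> decay n u e * slice_inner n u b b + decay n u (Suc e) * slice_inner n u h h"
    using Suc.prems by (intro add_right_mono mult_right_mono decay_antimono slice_inner_nonneg) auto
  also have "\<dots> \<le> slice_inner n (Suc u) (?D b) (?D b) + slice_inner n (Suc u) (?D h) (?D h)"
    using Suc.IH[OF b] Suc.prems top by simp
  also have "\<dots> = slice_inner n (Suc u) (?D c) (?D c)"
    using cross slice_inner_commute[of n "Suc u" "?D h" "?D b"]
    unfolding Dsplit by (simp add: slice_inner_add slice_inner_add_right)
  finally show ?case .
qed

section \<open>Interpolation between slices\<close>

text \<open>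
  The coefficients of the conditional expectation, given the prefix of size \<open>u\<close>, of the polynomial
  at the prefix of size \<open>s\<close>.
\<close>

definition shrink_coeff :: "nat \<Rightarrow> nat \<Rightarrow> (nat set \<Rightarrow> real) \<Rightarrow> nat set \<Rightarrow> real" where
  "shrink_coeff s u c T = real (s choose card T) / real (u choose card T) * c T"

lemma multilin_cong: "(\<And>T. T \<subseteq> A \<Longrightarrow> c T = b T) \<Longrightarrow> multilin c A = multilin b A"
  unfolding multilin_def by (intro sum.cong) auto

lemma multilin_prefix_cong:
  assumes "\<And>T. finite T \<Longrightarrow> card T \<le> u \<Longrightarrow> c T = b T"
  shows "multilin c (\<pi> ` {1..u}) = multilin b (\<pi> ` {1..u})"
proof (rule multilin_cong)
  fix T assume T: "T \<subseteq> \<pi> ` {1..u}"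
  have "card T \<le> card (\<pi> ` {1..u})" using T by (intro card_mono) auto
  also have "\<dots> \<le> u" using card_image_le[of "{1..u}" \<pi>] by simp
  finally show "c T = b T" using T finite_subset by (intro assms) blast+
qed

lemma shrink_coeff_self: "card T \<le> s \<Longrightarrow> shrink_coeff s s c T = c T"
  by (simp add: shrink_coeff_def)

lemma down_shrink_coeff:
  assumes "s \<le> u" "card T \<le> Suc u"
  shows "down_coeff u (shrink_coeff s u c) T = shrink_coeff s (Suc u) c T"
proof (cases "card T \<le> u")
  case True
  define t where "t = card T"
  have "Suc u * (u choose t) = (Suc u - t) * (Suc u choose t)"
    using binomial_absorb_comp[of "Suc u" t] by simp
  then have "real (Suc u) * real (u choose t) = real (Suc u - t) * real (Suc u choose t)"
    by (metis of_nat_mult)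
  then have e: "real (u choose t) / real (Suc u choose t) = 1 - real t / real (Suc u)"
    using True assms(2) by (simp add: t_def field_simps of_nat_diff)
  have pos: "real (u choose t) > 0" using True by (simp add: t_def)
  have "shrink_coeff s (Suc u) c T =
      (real (u choose t) / real (Suc u choose t)) * (real (s choose t) / real (u choose t) * c T)"
    using pos by (simp add: shrink_coeff_def t_def)
  then show ?thesis unfolding e by (simp add: down_coeff_def shrink_coeff_def t_def)
next
  case False
  then show ?thesis using assms by (simp add: down_coeff_def shrink_coeff_def binomial_eq_0)
qed

text \<open>
  The defining property of the conditional expectation. In the induction step the test function \<open>h\<close>
  of the larger prefix is first averaged to a function of the prefix of size \<open>u\<close>, where the
  hypothesis applies, and then moved back, leaving a single down step on the coefficients.
\<close>

lemma perm_mean_shrink: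
  assumes "s \<le> u" "u \<le> n"
  shows "perm_mean n (\<lambda>\<pi>. multilin c (\<pi> ` {1..s}) * h (\<pi> ` {1..u})) =
    perm_mean n (\<lambda>\<pi>. multilin (shrink_coeff s u c) (\<pi> ` {1..u}) * h (\<pi> ` {1..u}))"
  using assms
proof (induction u arbitrary: h rule: dec_induct)
  case base
  have "multilin (shrink_coeff s s c) (\<pi> ` {1..s}) = multilin c (\<pi> ` {1..s})" for \<pi>
    by (rule multilin_prefix_cong) (simp add: shrink_coeff_self)
  then show ?case by simp
next
  case (step u)
  let ?h = "\<lambda>B. (\<Sum>i\<in>{1..n} - B. h (insert i B)) / real (n - u)"
  have u: "u < n" using step by simp
  have "perm_mean n (\<lambda>\<pi>. multilin c (\<pi> ` {1..s}) * h (\<pi> ` {1..Suc u})) =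
      perm_mean n (\<lambda>\<pi>. multilin c (\<pi> ` {1..s}) * ?h (\<pi> ` {1..u}))"
    using perm_mean_step_up[OF step.hyps(1) u] .
  also have "\<dots> = perm_mean n (\<lambda>\<pi>. multilin (shrink_coeff s u c) (\<pi> ` {1..u}) * ?h (\<pi> ` {1..u}))"
    using step.IH[of ?h] u by simp
  also have "\<dots> = perm_mean n (\<lambda>\<pi>. multilin (shrink_coeff s u c) (\<pi> ` {1..u}) * h (\<pi> ` {1..Suc u}))"
    using perm_mean_step_up[OF order_refl u, of "multilin (shrink_coeff s u c)"] by simp
  also have "\<dots> = perm_mean n (\<lambda>\<pi>. multilin (down_coeff u (shrink_coeff s u c)) (\<pi> ` {1..Suc u})
      * h (\<pi> ` {1..Suc u}))"
    by (rule perm_mean_down[OF u])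
  also have "\<dots> = perm_mean n (\<lambda>\<pi>. multilin (shrink_coeff s (Suc u) c) (\<pi> ` {1..Suc u})
      * h (\<pi> ` {1..Suc u}))"
    by (intro perm_mean_cong arg_cong2[of _ _ _ _ "(*)"] multilin_prefix_cong
        down_shrink_coeff step.hyps) auto
  finally show ?case .
qed

text \<open>
  Pythagoras: the conditional expectation is an orthogonal projection, so the mean conditional
  variance is a difference of squared norms.
\<close>

lemma shrink_residual:
  assumes "s \<le> u" "u \<le> n"
  shows "perm_mean n (\<lambda>\<pi>. (multilin c (\<pi> ` {1..s}) - multilin (shrink_coeff s u c) (\<pi> ` {1..u}))\<^sup>2) =
    slice_inner n s c c - slice_inner n u (shrink_coeff s u c) (shrink_coeff s u c)"
proof -
  let ?F = "\<lambda>\<pi>. multilin c (\<pi> ` {1..s})" and ?G = "\<lambda>\<pi>. multilin (shrink_coeff s u c) (\<pi> ` {1..u})"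
  have "perm_mean n (\<lambda>\<pi>. (?F \<pi> - ?G \<pi>)\<^sup>2) =
      perm_mean n (\<lambda>\<pi>. ?F \<pi> * ?F \<pi> - 2 * (?F \<pi> * ?G \<pi>) + ?G \<pi> * ?G \<pi>)"
    by (intro perm_mean_cong) (simp add: power2_eq_square algebra_simps)
  also have "\<dots> = perm_mean n (\<lambda>\<pi>. ?F \<pi> * ?F \<pi>) - 2 * perm_mean n (\<lambda>\<pi>. ?F \<pi> * ?G \<pi>)
      + perm_mean n (\<lambda>\<pi>. ?G \<pi> * ?G \<pi>)"
    by (simp only: perm_mean_add perm_mean_diff perm_mean_cmult)
  also have "perm_mean n (\<lambda>\<pi>. ?F \<pi> * ?G \<pi>) = perm_mean n (\<lambda>\<pi>. ?G \<pi> * ?G \<pi>)"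
    by (rule perm_mean_shrink[OF assms])
  finally show ?thesis by (simp add: slice_inner_def)
qed

lemma shrink_norm_le:
  assumes "s \<le> u" "u \<le> n"
  shows "slice_inner n u (shrink_coeff s u c) (shrink_coeff s u c) \<le> slice_inner n s c c"
proof -
  have "0 \<le> perm_mean n (\<lambda>\<pi>. (multilin c (\<pi> ` {1..s}) - multilin (shrink_coeff s u c) (\<pi> ` {1..u}))\<^sup>2)"
    by (intro perm_mean_nonneg) simp
  then show ?thesis unfolding shrink_residual[OF assms] by simp
qed

text \<open>
  Each step loses at most the fraction \<open>\<kappa>\<close> by \<open>slice_decay\<close>, and
  \<open>(1 - m \<kappa>) (1 - \<kappa>) \<ge> 1 - (m + 1) \<kappa>\<close>.
\<close>

lemma shrink_norm_ge:
  assumes "s \<le> u" "u \<le> n" "degree_le d c" "\<kappa> \<le> 1"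
    and step: "\<And>w. s \<le> w \<Longrightarrow> w < u \<Longrightarrow>
      d \<le> Suc w \<and> d \<le> n - w \<and> real d / real (Suc w) + real d / real (n - w) \<le> \<kappa>"
  shows "slice_inner n u (shrink_coeff s u c) (shrink_coeff s u c) \<ge>
    (1 - real (u - s) * \<kappa>) * slice_inner n s c c"
  using assms(1,2) step
proof (induction u rule: dec_induct)
  case base
  have "multilin (shrink_coeff s s c) (\<pi> ` {1..s}) = multilin c (\<pi> ` {1..s})" for \<pi>
    by (rule multilin_prefix_cong) (simp add: shrink_coeff_self)
  then show ?case by (simp add: slice_inner_def)
next
  case (step u)
  let ?N = "slice_inner n s c c"
  let ?c = "shrink_coeff s u c"
  have u: "u < n" using step by simp
  have k: "d \<le> Suc u" "d \<le> n - u" "real d / real (Suc u) + real d / real (n - u) \<le> \<kappa>"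
    using step.prems(2)[of u] step.hyps by auto
  then have k0: "0 \<le> \<kappa>" by (smt (verit) divide_nonneg_nonneg of_nat_0_le_iff)
  have "(1 - real (Suc u - s) * \<kappa>) * ?N \<le> (1 - \<kappa>) * ((1 - real (u - s) * \<kappa>) * ?N)"
  proof -
    have "real (Suc u - s) = real (u - s) + 1" using step.hyps by (simp add: Suc_diff_le)
    moreover have "0 \<le> real (u - s) * \<kappa> * \<kappa>" using k0 by simp
    ultimately have "1 - real (Suc u - s) * \<kappa> \<le> (1 - \<kappa>) * (1 - real (u - s) * \<kappa>)"
      by (simp add: algebra_simps)
    then have "(1 - real (Suc u - s) * \<kappa>) * ?N \<le> (1 - \<kappa>) * (1 - real (u - s) * \<kappa>) * ?N"
      by (rule mult_right_mono[OF _ slice_inner_nonneg])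
    then show ?thesis by (simp only: mult.assoc)
  qed
  also have "\<dots> \<le> (1 - \<kappa>) * slice_inner n u ?c ?c"
    using step assms(4) by (intro mult_left_mono step.IH) auto
  also have "\<dots> \<le> decay n u d * slice_inner n u ?c ?c"
  proof (intro mult_right_mono slice_inner_nonneg)
    have "1 - \<kappa> \<le> 1 - (real d / real (Suc u) + real d / real (n - u))"
      by (rule diff_left_mono[OF k(3)])
    also have "\<dots> \<le> decay n u d"
    proof -
      have "1 - (a + b) \<le> (1 - a) * (1 - b)" if "0 \<le> a" "0 \<le> b" for a b :: real
        using mult_nonneg_nonneg[OF that] by (simp add: algebra_simps)
      then show ?thesis unfolding decay_def by simp
    qed
    finally show "1 - \<kappa> \<le> decay n u d" .
  qed
  also have "\<dots> \<le> slice_inner n (Suc u) (down_coeff u ?c) (down_coeff u ?c)"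
    using assms(3) k by (intro slice_decay u) (auto simp: degree_le_def shrink_coeff_def)
  also have "\<dots> = slice_inner n (Suc u) (shrink_coeff s (Suc u) c) (shrink_coeff s (Suc u) c)"
    unfolding slice_inner_def
    by (intro perm_mean_cong arg_cong2[of _ _ _ _ "(*)"] multilin_prefix_cong
        down_shrink_coeff step.hyps) auto
  finally show ?case .
qed

definition lagrange_basis :: "(nat \<Rightarrow> real) \<Rightarrow> nat set \<Rightarrow> nat \<Rightarrow> real \<Rightarrow> real" where
  "lagrange_basis x I i t = (\<Prod>j\<in>I - {i}. (t - x j) / (x i - x j))"

lemma lagrange_interpolation:
  fixes Q :: "real poly"
  assumes "finite I" "inj_on x I" "degree Q < card I"
  shows "poly Q t = (\<Sum>i\<in>I. lagrange_basis x I i t * poly Q (x i))"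
proof -
  define B where "B i = (\<Prod>j\<in>I - {i}. [:- x j / (x i - x j), 1 / (x i - x j):])" for i
  have poly_B: "poly (B i) t = lagrange_basis x I i t" for i t
    by (simp add: B_def lagrange_basis_def poly_prod diff_divide_distrib)
  define L where "L = (\<Sum>i\<in>I. smult (poly Q (x i)) (B i))"
  have "degree (B i) < card I" if "i \<in> I" for i
  proof -
    have "degree (B i) \<le> (\<Sum>j\<in>I - {i}. 1)"
      unfolding B_def using assms(1)
      by (intro order.trans[OF degree_prod_sum_le] sum_mono) (auto intro: degree_pCons_le order.trans)
    also have "\<dots> < card I" using assms(3) that by simp
    finally show ?thesis .
  qed
  then have dL: "degree L < card I"
    unfolding L_def using assms by (intro degree_sum_less) (auto intro: le_less_trans[OF degree_smult_le])
  have "Q = L"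
  proof (rule poly_eqI_degree[where A = "x ` I"])
    fix y assume "y \<in> x ` I"
    then obtain k where k: "k \<in> I" "y = x k" by auto
    have "lagrange_basis x I i (x k) = (if i = k then 1 else 0)" if "i \<in> I" for i
    proof (cases "i = k")
      case True
      have "x k \<noteq> x j" if "j \<in> I - {k}" for j using assms(2) k that by (auto dest: inj_onD)
      then show ?thesis using True by (simp add: lagrange_basis_def)
    next
      case False
      then show ?thesis using assms(1) k that by (auto simp: lagrange_basis_def intro!: prod_zero)
    qed
    then have "poly L y = (\<Sum>i\<in>I. poly Q (x i) * (if i = k then 1 else 0))"
      by (simp add: L_def poly_sum poly_B k)
    also have "\<dots> = (\<Sum>i\<in>I. if i = k then poly Q (x i) else 0)" by (intro sum.cong) auto
    also have "\<dots> = poly Q y" using k assms(1) by simp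
    finally show "poly Q y = poly L y" by simp
  qed (use assms dL in \<open>auto simp: card_image\<close>)
  then have "poly Q t = poly L t" by simp
  then show ?thesis by (simp add: L_def poly_sum poly_B mult.commute)
qed

lemma binomial_poly:
  obtains q :: "real poly" where "degree q \<le> t" "\<And>s. poly q (real s) = real (s choose t)"
proof
  let ?q = "smult (1 / fact t) (\<Prod>i<t. [:- real i, 1:])"
  have "degree (\<Prod>i<t. [:- real i, 1:]) \<le> (\<Sum>i<t. 1)"
    by (intro order.trans[OF degree_prod_sum_le] sum_mono) auto
  then show "degree ?q \<le> t" by simp
  show "poly ?q (real s) = real (s choose t)" for s
    by (simp add: poly_prod binomial_gbinomial gbinomial_prod_rev atLeast0LessThan)
qed

text \<open>
  As a function of \<open>s\<close> every coefficient is a multiple of \<open>s choose t\<close> with \<open>t \<le> d\<close>, hence a polynomial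
  of degree at most \<open>d\<close>; interpolation at \<open>d + 1\<close> nodes is exact.
\<close>

lemma shrink_interpolation:
  assumes "finite A" "finite I" "inj_on k I" "degree_le d c" "d < card I"
  shows "multilin (shrink_coeff s u c) A =
    (\<Sum>i\<in>I. lagrange_basis (\<lambda>i. real (k i)) I i (real s) * multilin (shrink_coeff (k i) u c) A)"
proof -
  let ?l = "\<lambda>i. lagrange_basis (\<lambda>i. real (k i)) I i (real s)"
  have "shrink_coeff s u c T = (\<Sum>i\<in>I. ?l i * shrink_coeff (k i) u c T)" for T
  proof (cases "card T \<le> d")
    case True
    obtain q :: "real poly" where q: "degree q \<le> card T" "\<And>s. poly q (real s) = real (s choose card T)"
      using binomial_poly by blast
    have "real (s choose card T) = (\<Sum>i\<in>I. ?l i * real (k i choose card T))"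
      unfolding q(2)[symmetric] using assms q(1) True
      by (intro lagrange_interpolation) (auto simp: inj_on_def)
    then have "shrink_coeff s u c T =
        (\<Sum>i\<in>I. ?l i * real (k i choose card T)) * (c T / real (u choose card T))"
      by (simp add: shrink_coeff_def)
    also have "\<dots> = (\<Sum>i\<in>I. ?l i * shrink_coeff (k i) u c T)"
      unfolding sum_distrib_right by (intro sum.cong) (simp_all add: shrink_coeff_def)
    finally show ?thesis .
  next
    case False
    then show ?thesis using assms(4) by (simp add: shrink_coeff_def degree_le_def)
  qed
  then have "multilin (shrink_coeff s u c) A = (\<Sum>T\<in>Pow A. \<Sum>i\<in>I. ?l i * shrink_coeff (k i) u c T)"
    by (simp add: multilin_def)
  also have "\<dots> = (\<Sum>i\<in>I. \<Sum>T\<in>Pow A. ?l i * shrink_coeff (k i) u c T)" by (rule sum.swap)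
  finally show ?thesis by (simp add: multilin_def sum_distrib_left)
qed

lemma weighted_square_le:
  fixes l y :: "'i \<Rightarrow> real"
  shows "(\<Sum>i\<in>I. l i * y i)\<^sup>2 \<le> (\<Sum>i\<in>I. \<bar>l i\<bar>) * (\<Sum>i\<in>I. \<bar>l i\<bar> * (y i)\<^sup>2)"
proof -
  have "(\<Sum>i\<in>I. l i * y i) = (\<Sum>i\<in>I. sqrt \<bar>l i\<bar> * (sgn (l i) * sqrt \<bar>l i\<bar> * y i))"
  proof (rule sum.cong[OF refl])
    fix i
    have "sqrt \<bar>l i\<bar> * (sgn (l i) * sqrt \<bar>l i\<bar> * y i) = sgn (l i) * (sqrt \<bar>l i\<bar> * sqrt \<bar>l i\<bar>) * y i"
      by (simp only: mult_ac)
    also have "\<dots> = l i * y i" by (simp add: sgn_mult_abs)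
    finally show "l i * y i = sqrt \<bar>l i\<bar> * (sgn (l i) * sqrt \<bar>l i\<bar> * y i)" by (rule sym)
  qed
  also have "\<dots>\<^sup>2 \<le> (\<Sum>i\<in>I. (sqrt \<bar>l i\<bar>)\<^sup>2) * (\<Sum>i\<in>I. (sgn (l i) * sqrt \<bar>l i\<bar> * y i)\<^sup>2)"
    by (rule Cauchy_Schwarz_ineq_sum)
  also have "\<dots> = (\<Sum>i\<in>I. \<bar>l i\<bar>) * (\<Sum>i\<in>I. \<bar>l i\<bar> * (y i)\<^sup>2)"
  proof -
    have "(sgn (l i) * sqrt \<bar>l i\<bar> * y i)\<^sup>2 = \<bar>l i\<bar> * (y i)\<^sup>2" for i
      by (simp add: power_mult_distrib sgn_if)
    then show ?thesis by simp
  qed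
  finally show ?thesis .
qed

lemma perm_mean_combination_le:
  assumes "\<And>i. i \<in> I \<Longrightarrow> perm_mean n (\<lambda>\<pi>. (Y i \<pi>)\<^sup>2) \<le> m" "0 \<le> m" "(\<Sum>i\<in>I. \<bar>l i\<bar>) \<le> \<Lambda>"
  shows "perm_mean n (\<lambda>\<pi>. (\<Sum>i\<in>I. l i * Y i \<pi>)\<^sup>2) \<le> \<Lambda>\<^sup>2 * m"
proof -
  let ?L = "\<Sum>i\<in>I. \<bar>l i\<bar>"
  have L: "0 \<le> ?L" by (intro sum_nonneg) simp
  have "perm_mean n (\<lambda>\<pi>. (\<Sum>i\<in>I. l i * Y i \<pi>)\<^sup>2) \<le>
      perm_mean n (\<lambda>\<pi>. ?L * (\<Sum>i\<in>I. \<bar>l i\<bar> * (Y i \<pi>)\<^sup>2))"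
    by (intro perm_mean_mono weighted_square_le)
  also have "\<dots> = ?L * (\<Sum>i\<in>I. \<bar>l i\<bar> * perm_mean n (\<lambda>\<pi>. (Y i \<pi>)\<^sup>2))"
    by (simp only: perm_mean_cmult perm_mean_sum)
  also have "\<dots> \<le> ?L * (\<Sum>i\<in>I. \<bar>l i\<bar> * m)"
    using assms(1) L by (intro mult_left_mono sum_mono) auto
  also have "\<dots> = ?L\<^sup>2 * m" by (simp add: sum_distrib_right[symmetric] power2_eq_square)
  also have "\<dots> \<le> \<Lambda>\<^sup>2 * m" using assms(2,3) L by (intro mult_right_mono power_mono) auto
  finally show ?thesis .
qed

text \<open>
  Let \<open>F\<close> be the value on a slice and \<open>G\<close> its conditional expectation given the prefix of size \<open>u\<close>.
  Interpolation being exact for \<open>G\<close>, the error equals that of \<open>F - G\<close>, whose mean squares are small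
  relative to the squared norm of \<open>F\<close>. On the nodes this norm is at most \<open>1\<close> by hypothesis. On slice
  \<open>s\<close> it is controlled through \<open>G\<close>: exactness bounds the squared norm of \<open>G\<close> by \<open>\<Lambda>\<^sup>2\<close>, and since
  \<open>\<beta> \<le> 1 / 2\<close> that of \<open>F\<close> is at most twice as large. The constant is \<open>6 = 2 * 2 + 2 * 1\<close>.
\<close>

lemma interpolation_error:
  assumes "finite I" "inj_on k I" "degree_le d c" "d < card I" "u \<le> n" "s \<le> u"
    and k: "\<And>i. i \<in> I \<Longrightarrow> k i \<le> u"
    and norm: "\<And>i. i \<in> I \<Longrightarrow> slice_inner n (k i) c c \<le> 1"
    and lip: "(\<Sum>i\<in>I. \<bar>lagrange_basis (\<lambda>i. real (k i)) I i (real s)\<bar>) \<le> \<Lambda>"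
    and \<beta>: "0 \<le> \<beta>" "\<beta> \<le> 1 / 2"
    and loss: "\<And>w. w = s \<or> w \<in> k ` I \<Longrightarrow>
      slice_inner n u (shrink_coeff w u c) (shrink_coeff w u c) \<ge> (1 - \<beta>) * slice_inner n w c c"
  shows "perm_mean n (\<lambda>\<pi>. (multilin c (\<pi> ` {1..s}) -
    (\<Sum>i\<in>I. lagrange_basis (\<lambda>i. real (k i)) I i (real s) * multilin c (\<pi> ` {1..k i})))\<^sup>2)
    \<le> 6 * \<beta> * \<Lambda>\<^sup>2"
proof -
  let ?l = "\<lambda>i. lagrange_basis (\<lambda>i. real (k i)) I i (real s)"
  let ?G = "\<lambda>w \<pi>. multilin (shrink_coeff w u c) (\<pi> ` {1..u})"
  let ?D = "\<lambda>w \<pi>. multilin c (\<pi> ` {1..w}) - ?G w \<pi>"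
  let ?N = "\<lambda>w. slice_inner n w c c" and ?M = "\<lambda>w. slice_inner n u (shrink_coeff w u c) (shrink_coeff w u c)"
  have G: "?G s \<pi> = (\<Sum>i\<in>I. ?l i * ?G (k i) \<pi>)" for \<pi> :: "nat \<Rightarrow> nat"
    using assms(1-4) by (intro shrink_interpolation) auto
  have M_eq: "?M w = perm_mean n (\<lambda>\<pi>. (?G w \<pi>)\<^sup>2)" for w
    by (simp add: slice_inner_def power2_eq_square)
  have Ms: "?M s \<le> \<Lambda>\<^sup>2 * 1"
    unfolding M_eq G
  proof (rule perm_mean_combination_le[OF _ _ lip])
    fix i assume i: "i \<in> I"
    have "?M (k i) \<le> ?N (k i)" using k[OF i] assms(5) by (rule shrink_norm_le)
    then show "perm_mean n (\<lambda>\<pi>. (?G (k i) \<pi>)\<^sup>2) \<le> 1" using norm[OF i] by (simp add: M_eq)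
  qed simp
  have res: "perm_mean n (\<lambda>\<pi>. (?D w \<pi>)\<^sup>2) \<le> \<beta> * ?N w" if "w = s \<or> w \<in> k ` I" for w
  proof -
    have "w \<le> u" using that k assms(6) by auto
    show ?thesis
      unfolding shrink_residual[OF \<open>w \<le> u\<close> assms(5)] using loss[OF that]
      by (simp add: left_diff_distrib)
  qed
  have "1 / 2 * ?N s \<le> (1 - \<beta>) * ?N s"
    using \<beta> by (intro mult_right_mono slice_inner_nonneg) auto
  also have "\<dots> \<le> ?M s" by (rule loss) simp
  finally have "?N s \<le> 2 * \<Lambda>\<^sup>2" using Ms by linarith
  then have "\<beta> * ?N s \<le> \<beta> * (2 * \<Lambda>\<^sup>2)" using \<beta> by (intro mult_left_mono) auto
  then have rs: "perm_mean n (\<lambda>\<pi>. (?D s \<pi>)\<^sup>2) \<le> \<beta> * (2 * \<Lambda>\<^sup>2)"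
    using res[of s] by linarith
  have rk: "perm_mean n (\<lambda>\<pi>. (\<Sum>i\<in>I. ?l i * ?D (k i) \<pi>)\<^sup>2) \<le> \<Lambda>\<^sup>2 * \<beta>"
  proof (rule perm_mean_combination_le[OF _ \<beta>(1) lip])
    fix i assume i: "i \<in> I"
    have "\<beta> * ?N (k i) \<le> \<beta> * 1" using norm[OF i] \<beta> by (intro mult_left_mono) auto
    then show "perm_mean n (\<lambda>\<pi>. (?D (k i) \<pi>)\<^sup>2) \<le> \<beta>" using res[of "k i"] i by auto
  qed
  have "perm_mean n (\<lambda>\<pi>. (multilin c (\<pi> ` {1..s}) - (\<Sum>i\<in>I. ?l i * multilin c (\<pi> ` {1..k i})))\<^sup>2) \<le>
      perm_mean n (\<lambda>\<pi>. 2 * (?D s \<pi>)\<^sup>2 + 2 * (\<Sum>i\<in>I. ?l i * ?D (k i) \<pi>)\<^sup>2)"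
  proof (rule perm_mean_mono)
    fix \<pi> :: "nat \<Rightarrow> nat"
    have "(\<Sum>i\<in>I. ?l i * ?D (k i) \<pi>) = (\<Sum>i\<in>I. ?l i * multilin c (\<pi> ` {1..k i})) - ?G s \<pi>"
      unfolding G by (simp add: right_diff_distrib sum_subtractf)
    then have e: "multilin c (\<pi> ` {1..s}) - (\<Sum>i\<in>I. ?l i * multilin c (\<pi> ` {1..k i})) =
        ?D s \<pi> - (\<Sum>i\<in>I. ?l i * ?D (k i) \<pi>)" by simp
    have "(a - b)\<^sup>2 \<le> 2 * a\<^sup>2 + 2 * b\<^sup>2" for a b :: real
      using zero_le_power2[of "a + b"] by (simp add: power2_eq_square algebra_simps)
    then show "(multilin c (\<pi> ` {1..s}) - (\<Sum>i\<in>I. ?l i * multilin c (\<pi> ` {1..k i})))\<^sup>2 \<le>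
        2 * (?D s \<pi>)\<^sup>2 + 2 * (\<Sum>i\<in>I. ?l i * ?D (k i) \<pi>)\<^sup>2" unfolding e .
  qed
  also have "\<dots> = 2 * perm_mean n (\<lambda>\<pi>. (?D s \<pi>)\<^sup>2)
      + 2 * perm_mean n (\<lambda>\<pi>. (\<Sum>i\<in>I. ?l i * ?D (k i) \<pi>)\<^sup>2)"
    by (simp only: perm_mean_add perm_mean_cmult)
  also have "\<dots> \<le> 6 * \<beta> * \<Lambda>\<^sup>2" using rs rk by (simp add: algebra_simps)
  finally show ?thesis .
qed

section \<open>Polynomials, slices and the product measure\<close>

text \<open>
  For a multilinear polynomial at most one monomial has support \<open>T\<close>; summing over the monomials with
  this support avoids having to construct it.
\<close>

definition rpoly_coeff :: "rpoly \<Rightarrow> nat set \<Rightarrow> real" where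
  "rpoly_coeff f T = (\<Sum>m | m \<in> Poly_Mapping.keys f \<and> Poly_Mapping.keys m = T. Poly_Mapping.lookup f m)"

lemma multilinear_lookup:
  assumes "multilinear f" "m \<in> Poly_Mapping.keys f" "i \<in> Poly_Mapping.keys m"
  shows "Poly_Mapping.lookup m i = 1"
proof -
  have "Poly_Mapping.lookup m i \<le> 1"
    using assms(1,2) by (simp add: multilinear_def squarefree_monomial_def)
  moreover have "Poly_Mapping.lookup m i \<noteq> 0" using assms(3) by (simp add: in_keys_iff)
  ultimately show ?thesis by linarith
qed

lemma rpoly_eval_indicator:
  assumes "multilinear f" "finite A"
  shows "rpoly_eval f (\<lambda>i. if i \<in> A then 1 else 0) = multilin (rpoly_coeff f) A"
proof -
  let ?K = "Poly_Mapping.keys f"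
  have "rpoly_eval f (\<lambda>i. if i \<in> A then 1 else 0) =
      (\<Sum>m\<in>?K. if Poly_Mapping.keys m \<in> Pow A then Poly_Mapping.lookup f m else 0)"
    unfolding rpoly_eval_def
  proof (rule sum.cong[OF refl])
    fix m assume m: "m \<in> ?K"
    have "(\<Prod>i\<in>Poly_Mapping.keys m. (if i \<in> A then 1 else 0) ^ Poly_Mapping.lookup m i) =
        (\<Prod>i\<in>Poly_Mapping.keys m. if i \<in> A then 1 else (0::real))"
      by (intro prod.cong) (auto simp: multilinear_lookup[OF assms(1) m])
    also have "\<dots> = (if Poly_Mapping.keys m \<in> Pow A then 1 else 0)"
    proof (cases "Poly_Mapping.keys m \<subseteq> A")
      case True
      then show ?thesis by (auto intro!: prod.neutral)
    next
      case False
      then show ?thesis by (auto intro!: prod_zero)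
    qed
    finally show "Poly_Mapping.lookup f m *
        (\<Prod>i\<in>Poly_Mapping.keys m. (if i \<in> A then 1 else 0) ^ Poly_Mapping.lookup m i) =
        (if Poly_Mapping.keys m \<in> Pow A then Poly_Mapping.lookup f m else 0)"
      by simp
  qed
  also have "\<dots> = (\<Sum>m\<in>{m \<in> ?K. Poly_Mapping.keys m \<in> Pow A}. Poly_Mapping.lookup f m)"
    by (simp add: sum.inter_filter)
  also have "\<dots> = (\<Sum>T\<in>Pow A. \<Sum>m | m \<in> {m \<in> ?K. Poly_Mapping.keys m \<in> Pow A} \<and> Poly_Mapping.keys m = T.
      Poly_Mapping.lookup f m)"
    using assms(2) by (intro sum.group[symmetric]) auto
  also have "\<dots> = multilin (rpoly_coeff f) A"
    unfolding multilin_def rpoly_coeff_def by (intro sum.cong) auto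
  finally show ?thesis .
qed

lemma rpoly_eval_coupling_point:
  "multilinear f \<Longrightarrow> rpoly_eval f (coupling_point \<pi> s) = multilin (rpoly_coeff f) (\<pi> ` {1..s})"
  unfolding coupling_point_def by (rule rpoly_eval_indicator) auto

lemma degree_le_rpoly_coeff:
  assumes "multilinear f" "rpoly_degree f \<le> d"
  shows "degree_le d (rpoly_coeff f)"
  unfolding degree_le_def
proof (intro allI impI)
  fix T :: "nat set" assume T: "d < card T"
  have "Poly_Mapping.keys m \<noteq> T" if m: "m \<in> Poly_Mapping.keys f" for m
  proof
    assume e: "Poly_Mapping.keys m = T"
    have "card T = monomial_degree m"
      unfolding monomial_degree_def e[symmetric] by (simp add: multilinear_lookup[OF assms(1) m])
    also have "\<dots> \<le> rpoly_degree f"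
      unfolding rpoly_degree_def using m by (intro Max_ge) auto
    finally show False using T assms(2) by simp
  qed
  then show "rpoly_coeff f T = 0"
    unfolding rpoly_coeff_def by (intro sum.neutral) auto
qed

lemma set_random_permutation: "set_pmf (random_permutation n) = {\<pi>. \<pi> permutes {1..n}}"
proof -
  have "{\<pi>. \<pi> permutes {1..n}} \<noteq> {}" using permutes_id by blast
  then show ?thesis
    unfolding random_permutation_def by (intro set_pmf_of_set) (simp_all add: finite_permutations)
qed

lemma expectation_random_permutation:
  "measure_pmf.expectation (random_permutation n) \<Phi> = perm_mean n \<Phi>"
proof -
  have ne: "{\<pi>. \<pi> permutes {1..n}} \<noteq> {}" using permutes_id by blast
  have fin: "finite {\<pi>. \<pi> permutes {1..n}}" by (simp add: finite_permutations)
  have "card {\<pi>. \<pi> permutes {1..n}} = fact n" by (rule card_permutations) auto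
  then show ?thesis
    unfolding random_permutation_def perm_mean_def
    by (subst integral_pmf_of_set[OF ne fin]) simp
qed

lemma prob_random_permutation:
  "measure_pmf.prob (random_permutation n) S = perm_mean n (indicator S)"
  unfolding expectation_random_permutation[symmetric] by simp

lemma markov_random_permutation:
  assumes "0 < \<delta>"
  shows "measure_pmf.prob (random_permutation n) {\<pi>. \<delta> < \<bar>Y \<pi>\<bar>} \<le> perm_mean n (\<lambda>\<pi>. (Y \<pi>)\<^sup>2) / \<delta>\<^sup>2"
proof -
  have "perm_mean n (indicator {\<pi>. \<delta> < \<bar>Y \<pi>\<bar>}) \<le> perm_mean n (\<lambda>\<pi>. 1 / \<delta>\<^sup>2 * (Y \<pi>)\<^sup>2)"
  proof (rule perm_mean_mono)
    fix \<pi> :: "nat \<Rightarrow> nat"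
    have "\<delta>\<^sup>2 \<le> (Y \<pi>)\<^sup>2" if "\<delta> < \<bar>Y \<pi>\<bar>"
      using that assms power_mono[of \<delta> "\<bar>Y \<pi>\<bar>" 2] by simp
    then show "indicator {\<pi>. \<delta> < \<bar>Y \<pi>\<bar>} \<pi> \<le> 1 / \<delta>\<^sup>2 * (Y \<pi>)\<^sup>2"
      using assms by (auto simp: indicator_def)
  qed
  also have "\<dots> = perm_mean n (\<lambda>\<pi>. (Y \<pi>)\<^sup>2) / \<delta>\<^sup>2"
    by (subst perm_mean_cmult) simp
  finally show ?thesis by (simp add: prob_random_permutation)
qed

lemma slice_eq_image:
  "slice n s = (\<lambda>A i. if i \<in> A then 1 else 0) ` {A. A \<subseteq> {1..n} \<and> card A = s}"
proof (intro set_eqI iffI)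
  fix x assume "x \<in> slice n s"
  then have x: "\<And>i. i \<in> {1..n} \<Longrightarrow> x i = 0 \<or> x i = 1" "\<And>i. i \<notin> {1..n} \<Longrightarrow> x i = 0"
      and s: "(\<Sum>i=1..n. x i) = real s"
    by (auto simp: slice_def cube_def PiE_dflt_def)
  let ?A = "{i \<in> {1..n}. x i = 1}"
  have xA: "x = (\<lambda>i. if i \<in> ?A then 1 else 0)"
    using x by (intro ext) (smt (verit, best) mem_Collect_eq)
  have "(\<Sum>i=1..n. x i) = (\<Sum>i\<in>{1..n}. if x i = 1 then 1 else 0)"
    using x(1) by (intro sum.cong) auto
  also have "\<dots> = real (card ?A)" by (simp add: sum.inter_filter[symmetric])
  finally have "card ?A = s" using s by simp
  then show "x \<in> (\<lambda>A i. if i \<in> A then 1 else 0) ` {A. A \<subseteq> {1..n} \<and> card A = s}"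
    using xA by (intro image_eqI[where x = ?A]) auto
next
  fix x assume "x \<in> (\<lambda>A i. if i \<in> A then 1 else (0::real)) ` {A. A \<subseteq> {1..n} \<and> card A = s}"
  then obtain A where A: "A \<subseteq> {1..n}" "card A = s" and x: "x = (\<lambda>i. if i \<in> A then 1 else 0)" by auto
  have "(\<Sum>i=1..n. x i) = (\<Sum>i\<in>A. 1)"
    unfolding x using A by (intro sum.mono_neutral_cong_right) auto
  then show "x \<in> slice n s" using A by (auto simp: slice_def cube_def PiE_dflt_def x)
qed

lemma finite_slice: "finite (slice n s)"
  unfolding slice_eq_image by simp

lemma card_slice: "card (slice n s) = n choose s"
proof -
  have "inj_on (\<lambda>A i. if i \<in> A then 1 else (0::real)) {A. A \<subseteq> {1..n} \<and> card A = s}"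
    by (rule inj_onI) (auto simp: fun_eq_iff split: if_splits)
  then show ?thesis unfolding slice_eq_image by (simp add: card_image n_subsets)
qed

lemma coupling_point_in_slice:
  assumes "\<pi> permutes {1..n}" "s \<le> n"
  shows "coupling_point \<pi> s \<in> slice n s"
  unfolding slice_eq_image coupling_point_def
  using perm_image_subset[OF assms] card_perm_image[OF assms(1), of "{1..s}"] by auto

lemma perm_transitive:
  fixes n :: nat
  assumes "A \<subseteq> {1..n}" "B \<subseteq> {1..n}" "card A = card B"
  obtains \<rho> where "\<rho> permutes {1..n}" "\<rho> ` A = B"
proof -
  have fin: "finite A" "finite B" using assms finite_subset by blast+
  obtain f where f: "bij_betw f A B" using finite_same_card_bij[OF fin assms(3)] by auto
  have "card ({1..n} - A) = card ({1..n} - B)" using assms fin by (simp add: card_Diff_subset)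
  then obtain g where g: "bij_betw g ({1..n} - A) ({1..n} - B)"
    using finite_same_card_bij[of "{1..n} - A" "{1..n} - B"] by auto
  \<comment> \<open>Glue a bijection of the sets to one of their complements.\<close>
  define \<rho> where "\<rho> i = (if i \<in> A then f i else if i \<in> {1..n} then g i else i)" for i
  have 1: "bij_betw \<rho> A B" using f by (rule bij_betw_cong[THEN iffD1, rotated]) (simp add: \<rho>_def)
  have 2: "bij_betw \<rho> ({1..n} - A) ({1..n} - B)"
    using g by (rule bij_betw_cong[THEN iffD1, rotated]) (simp add: \<rho>_def)
  have "bij_betw \<rho> (A \<union> ({1..n} - A)) (B \<union> ({1..n} - B))"
    using 1 2 by (rule bij_betw_combine) auto
  then have "bij_betw \<rho> {1..n} {1..n}" using assms by (simp add: Un_absorb1)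
  then have "\<rho> permutes {1..n}"
    by (rule bij_imp_permutes) (use assms(1) in \<open>auto simp: \<rho>_def\<close>)
  then show ?thesis using 1 that by (auto simp: bij_betw_def)
qed

text \<open>
  The symmetric group acts on the left of a uniform permutation and transitively on the subsets of
  a given size, so all points of the slice are equally likely.
\<close>

lemma map_coupling_point:
  assumes "s \<le> n"
  shows "map_pmf (\<lambda>\<pi>. coupling_point \<pi> s) (random_permutation n) = nu n s"
proof -
  let ?M = "map_pmf (\<lambda>\<pi>. coupling_point \<pi> s) (random_permutation n)"
  have sub: "set_pmf ?M \<subseteq> slice n s"
    using coupling_point_in_slice assms by (auto simp: set_random_permutation)
  have same: "pmf ?M x = pmf ?M y" if "x \<in> slice n s" "y \<in> slice n s" for x y
  proof -
    obtain A B where A: "A \<subseteq> {1..n}" "card A = s" "x = (\<lambda>i. if i \<in> A then 1 else 0)"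
      and B: "B \<subseteq> {1..n}" "card B = s" "y = (\<lambda>i. if i \<in> B then 1 else 0)"
      using \<open>x \<in> slice n s\<close> \<open>y \<in> slice n s\<close> unfolding slice_eq_image by auto
    obtain \<rho> where \<rho>: "\<rho> permutes {1..n}" "\<rho> ` A = B" using perm_transitive[of A n B] A B by auto
    have pt: "coupling_point \<pi> s = (\<lambda>i. if i \<in> C then 1 else 0) \<longleftrightarrow> \<pi> ` {1..s} = C" for \<pi> C
      unfolding coupling_point_def by (auto simp: fun_eq_iff split: if_splits)
    have pm: "pmf ?M (\<lambda>i. if i \<in> C then 1 else 0) =
        perm_mean n (\<lambda>\<pi>. if \<pi> ` {1..s} = C then 1 else 0)" for C
      unfolding pmf_map prob_random_permutation
      by (intro perm_mean_cong) (simp add: indicator_def pt)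
    have "perm_mean n (\<lambda>\<pi>. if \<pi> ` {1..s} = B then 1 else 0) =
        perm_mean n (\<lambda>\<pi>. if (\<rho> \<circ> \<pi>) ` {1..s} = B then 1 else 0)"
      unfolding perm_mean_def
        setum_permutations_compose_left[OF \<rho>(1), of "\<lambda>\<pi>. if \<pi> ` {1..s} = B then 1 else 0"] ..
    also have "\<dots> = perm_mean n (\<lambda>\<pi>. if \<pi> ` {1..s} = A then 1 else 0)"
    proof (rule perm_mean_cong)
      fix \<pi> :: "nat \<Rightarrow> nat"
      have "(\<rho> \<circ> \<pi>) ` {1..s} = B \<longleftrightarrow> \<rho> ` (\<pi> ` {1..s}) = \<rho> ` A" using \<rho>(2) by (simp add: image_comp)
      also have "\<dots> \<longleftrightarrow> \<pi> ` {1..s} = A" using permutes_inj[OF \<rho>(1)] by (rule inj_image_eq_iff)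
      finally show "(if (\<rho> \<circ> \<pi>) ` {1..s} = B then 1 else 0) = (if \<pi> ` {1..s} = A then 1 else (0::real))"
        by simp
    qed
    finally show ?thesis unfolding A(3) B(3) pm by simp
  qed
  have ne: "slice n s \<noteq> {}" using card_slice[of n s] assms by auto
  have total: "(\<Sum>x\<in>slice n s. pmf ?M x) = 1"
    using sub by (intro sum_pmf_eq_1 finite_slice)
  have val: "pmf ?M x = 1 / card (slice n s)" if x: "x \<in> slice n s" for x
  proof -
    have "(\<Sum>y\<in>slice n s. pmf ?M y) = (\<Sum>y\<in>slice n s. pmf ?M x)"
      by (rule sum.cong[OF refl]) (rule same[OF _ x])
    then show ?thesis using total ne finite_slice by (simp add: field_simps)
  qed
  show ?thesis
  proof (rule pmf_eqI)
    fix x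
    show "pmf ?M x = pmf (nu n s) x"
    proof (cases "x \<in> slice n s")
      case True
      then show ?thesis using val ne finite_slice by (simp add: nu_def)
    next
      case False
      then have "pmf ?M x = 0" using sub by (auto simp: pmf_eq_0_set_pmf simp del: set_map_pmf)
      then show ?thesis using False ne finite_slice by (simp add: nu_def)
    qed
  qed
qed

lemma L2_norm_slice:
  assumes "multilinear f" "s \<le> n" "L2_norm_pmf (nu n s) (rpoly_eval f) \<le> 1"
  shows "slice_inner n s (rpoly_coeff f) (rpoly_coeff f) \<le> 1"
proof -
  have "measure_pmf.expectation (nu n s) (\<lambda>x. (rpoly_eval f x)\<^sup>2) =
      perm_mean n (\<lambda>\<pi>. (rpoly_eval f (coupling_point \<pi> s))\<^sup>2)"
    unfolding map_coupling_point[OF assms(2), symmetric] by (simp add: expectation_random_permutation)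
  also have "\<dots> = slice_inner n s (rpoly_coeff f) (rpoly_coeff f)"
    by (simp only: rpoly_eval_coupling_point[OF assms(1)] slice_inner_def power2_eq_square)
  finally show ?thesis using assms(3) by (simp add: L2_norm_pmf_def)
qed

text \<open>
  A point with \<open>j\<close> ones has mass \<open>p\<^sup>j (1 - p)\<^sup>n\<^sup>-\<^sup>j\<close>, and in the mixture only slice \<open>j\<close> contributes;
  the binomial coefficient cancels against the size of the slice.
\<close>

lemma mu_eq_mixture:
  assumes "0 < p" "p < 1"
  shows "mu n p = bind_pmf (binomial_pmf n p) (nu n)"
proof (rule pmf_eqI)
  fix x
  have fin: "set_pmf (binomial_pmf n p) = {..n}" using assms by simp
  have bind: "pmf (bind_pmf (binomial_pmf n p) (nu n)) x =
      (\<Sum>s\<le>n. pmf (nu n s) x * ((n choose s) * p ^ s * (1 - p) ^ (n - s)))"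
    unfolding pmf_bind using fin assms
    by (subst integral_measure_pmf_real[where A = "{..n}"]) auto
  have nu: "pmf (nu n s) x = (if x \<in> slice n s then 1 / (n choose s) else 0)" if "s \<le> n" for s
  proof -
    have "slice n s \<noteq> {}" using card_slice[of n s] that by auto
    then show ?thesis by (simp add: nu_def finite_slice card_slice)
  qed
  show "pmf (mu n p) x = pmf (bind_pmf (binomial_pmf n p) (nu n)) x"
  proof (cases "x \<in> cube n")
    case True
    then have "\<forall>i\<in>{1..n}. x i = 0 \<or> x i = 1" by (auto simp: cube_def PiE_dflt_def)
    let ?A = "{i \<in> {1..n}. x i = 1}"
    define j where "j = card ?A"
    have "card ?A \<le> card {1..n}" by (intro card_mono) auto
    then have jn: "j \<le> n" by (simp add: j_def)
    have "(\<Sum>i=1..n. x i) = (\<Sum>i\<in>{1..n}. if x i = 1 then 1 else 0)"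
      using \<open>\<forall>i\<in>{1..n}. x i = 0 \<or> x i = 1\<close> by (intro sum.cong) auto
    also have "\<dots> = real j" by (simp add: j_def sum.inter_filter[symmetric])
    finally have j: "(\<Sum>i=1..n. x i) = real j" .
    then have "x \<in> slice n s \<longleftrightarrow> s = j" for s using True by (auto simp: slice_def)
    then have "pmf (bind_pmf (binomial_pmf n p) (nu n)) x =
        (\<Sum>s\<le>n. if s = j then p ^ s * (1 - p) ^ (n - s) else 0)"
      unfolding bind by (intro sum.cong refl) (simp add: nu)
    also have "\<dots> = p ^ j * (1 - p) ^ (n - j)" using jn by simp
    also have "\<dots> = pmf (mu n p) x"
      using jn assms
      by (simp add: pmf_mu[OF assms True] j sum_subtractf powr_realpow[symmetric] of_nat_diff
          del: One_nat_def)
    finally show ?thesis by simp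
  next
    case False
    have "set_pmf (map_pmf of_bool (bernoulli_pmf p)) \<subseteq> {0, 1 :: real}" by (auto simp: of_bool_def)
    then have "PiE_dflt {1..n} 0 (\<lambda>_. set_pmf (map_pmf of_bool (bernoulli_pmf p))) \<subseteq> cube n"
      unfolding cube_def PiE_dflt_def by blast
    then have "set_pmf (mu n p) \<subseteq> cube n"
      unfolding mu_def by (subst set_Pi_pmf) (simp_all add: o_def)
    then have "pmf (mu n p) x = 0" using False by (auto simp: pmf_eq_0_set_pmf)
    moreover have "x \<notin> slice n s" for s using False by (simp add: slice_def)
    ultimately show ?thesis unfolding bind by (simp add: nu)
  qed
qed

lemma prob_mu_mixture:
  assumes "0 < p" "p < 1"
  shows "measure_pmf.prob (mu n p) X = measure_pmf.expectation (binomial_pmf n p)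
    (\<lambda>s. measure_pmf.prob (random_permutation n) {\<pi>. coupling_point \<pi> s \<in> X})"
proof -
  have fin: "set_pmf (binomial_pmf n p) = {..n}" using assms by simp
  let ?N = "\<lambda>s. map_pmf (\<lambda>\<pi>. coupling_point \<pi> s) (random_permutation n)"
  have finN: "finite (set_pmf (?N s))" for s
    by (simp add: set_random_permutation finite_permutations)
  have "mu n p = bind_pmf (binomial_pmf n p) (\<lambda>s. map_pmf (\<lambda>\<pi>. coupling_point \<pi> s) (random_permutation n))"
    unfolding mu_eq_mixture[OF assms]
    by (intro bind_pmf_cong refl) (simp only: fin atMost_iff map_coupling_point)
  then have "measure_pmf.prob (mu n p) X =
      measure_pmf.expectation (bind_pmf (binomial_pmf n p) ?N) (indicator X)" by simp
  also have "\<dots> = (\<Sum>s\<in>{..n}. pmf (binomial_pmf n p) s *\<^sub>R measure_pmf.expectation (?N s) (indicator X))"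
    using finN by (intro pmf_expectation_bind) (auto simp: fin)
  also have "\<dots> = measure_pmf.expectation (binomial_pmf n p)
      (\<lambda>s. measure_pmf.expectation (?N s) (indicator X))"
    by (intro integral_measure_pmf[symmetric]) (auto simp: fin)
  finally show ?thesis by (simp add: vimage_def)
qed

section \<open>Transfer of distribution functions\<close>

lemma levy_dist_le:
  assumes "prob_space Q"
    and "\<And>t. cdf P t \<le> cdf Q (t + e) + e" "\<And>t. cdf Q t \<le> cdf P (t + e) + e"
  shows "levy_dist P Q \<le> e"
proof -
  let ?S = "{\<epsilon>. \<forall>t. cdf P (t - \<epsilon>) - \<epsilon> \<le> cdf Q t \<and> cdf Q t \<le> cdf P (t + \<epsilon>) + \<epsilon>}"
  have bd: "0 \<le> cdf P t" "cdf Q t \<le> 1" for t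
    using assms(1) by (auto simp: cdf_def prob_space.prob_le_1)
  have "-1 \<le> \<epsilon>" if "\<epsilon> \<in> ?S" for \<epsilon>
  proof -
    have "cdf P (0 - \<epsilon>) - \<epsilon> \<le> cdf Q 0" using that by blast
    then show ?thesis using bd(1)[of "0 - \<epsilon>"] bd(2)[of 0] by linarith
  qed
  then have "bdd_below ?S" by (rule bdd_belowI)
  moreover have "cdf P (t - e) - e \<le> cdf Q t" for t using assms(2)[of "t - e"] by simp
  then have "e \<in> ?S" using assms(3) by simp
  ultimately show ?thesis unfolding levy_dist_def by (rule cInf_lower[rotated])
qed

lemma levy_prokhorov_dist_commute: "levy_prokhorov_dist r P Q = levy_prokhorov_dist r Q P"
  unfolding levy_prokhorov_dist_def by (simp only: conj_commute)

lemma halfspace_in_sets: "{y \<in> space (Rn_borel r). (\<Sum>i\<in>{1..r}. l i * y i) \<le> t} \<in> sets (Rn_borel r)"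
proof -
  have "(\<lambda>y. \<Sum>i\<in>{1..r}. l i * y i) \<in> borel_measurable (Rn_borel r)"
    by (intro borel_measurable_sum borel_measurable_times borel_measurable_const
        measurable_component_singleton)
  then show ?thesis by measurable
qed

text \<open>
  A point within distance \<open>e\<close> of a half-space changes the linear form by at most \<open>\<Lambda> e\<close>. The distance is
  an infimum that need not be attained, whence the strict bound \<open>e\<close>: it leaves room for an
  admissible \<open>e' < e\<close> and for a point of the half-space closer than \<open>e\<close>.
\<close>

lemma levy_prokhorov_halfspace:
  assumes "prob_space P" "prob_space Q" and sets: "sets P = sets (Rn_borel r)" "sets Q = sets (Rn_borel r)"
    and "1 \<le> r" "levy_prokhorov_dist r P Q < e" and lip: "(\<Sum>i\<in>{1..r}. \<bar>l i\<bar>) \<le> \<Lambda>"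
  shows "measure P {y \<in> space (Rn_borel r). (\<Sum>i\<in>{1..r}. l i * y i) \<le> t} \<le>
    measure Q {y \<in> space (Rn_borel r). (\<Sum>i\<in>{1..r}. l i * y i) \<le> t + \<Lambda> * e} + e"
proof -
  interpret P: prob_space P by fact
  interpret Q: prob_space Q by fact
  let ?H = "\<lambda>t. {y \<in> space (Rn_borel r). (\<Sum>i\<in>{1..r}. l i * y i) \<le> t}"
  let ?S = "{\<epsilon>. \<forall>A\<in>sets (Rn_borel r).
      measure P A \<le> measure Q (Linf_enlarge r \<epsilon> A) + \<epsilon> \<and>
      measure Q A \<le> measure P (Linf_enlarge r \<epsilon> A) + \<epsilon>}"
  note H = halfspace_in_sets[of r l]
  have "1 \<in> ?S" using P.prob_le_1 Q.prob_le_1 by (simp add: add_increasing)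
  then have ne: "?S \<noteq> {}" by blast
  have "Inf ?S < e" using assms(6) by (simp only: levy_prokhorov_dist_def)
  from cInf_lessD[OF ne this] obtain e' where e': "e' \<in> ?S" "e' < e" by blast
  have "Linf_enlarge r e' (?H t) \<subseteq> ?H (t + \<Lambda> * e)"
  proof
    fix y assume "y \<in> Linf_enlarge r e' (?H t)"
    then have y: "y \<in> space (Rn_borel r)" "?H t \<noteq> {}" "(INF x\<in>?H t. Linf_dist r x y) \<le> e'"
      by (auto simp: Linf_enlarge_def)
    have ge: "\<bar>x i - y i\<bar> \<le> Linf_dist r x y" if "i \<in> {1..r}" for x i
      unfolding Linf_dist_def using that by (intro Max_ge) auto
    have "0 \<le> Linf_dist r x y" for x
      using order.trans[OF abs_ge_zero ge[of 1 x]] \<open>1 \<le> r\<close> by simp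
    then have "bdd_below ((\<lambda>x. Linf_dist r x y) ` ?H t)" by (intro bdd_belowI[of _ 0]) auto
    moreover have "(INF x\<in>?H t. Linf_dist r x y) < e" using y(3) e'(2) by linarith
    ultimately have "\<exists>x\<in>?H t. Linf_dist r x y < e"
      by (rule cINF_less_iff[OF y(2), THEN iffD1])
    then obtain x where x: "x \<in> ?H t" "Linf_dist r x y < e" by (elim bexE)
    have "0 < e" using x(2) \<open>\<And>x. 0 \<le> Linf_dist r x y\<close>[of x] by linarith
    have "(\<Sum>i\<in>{1..r}. l i * y i) - (\<Sum>i\<in>{1..r}. l i * x i) = (\<Sum>i\<in>{1..r}. l i * (y i - x i))"
      by (simp add: sum_subtractf right_diff_distrib)
    also have "\<dots> \<le> (\<Sum>i\<in>{1..r}. \<bar>l i\<bar> * e)"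
    proof (rule sum_mono)
      fix i assume i: "i \<in> {1..r}"
      have "l i * (y i - x i) \<le> \<bar>l i\<bar> * \<bar>x i - y i\<bar>"
        by (metis abs_ge_self abs_minus_commute abs_mult)
      also have "\<dots> \<le> \<bar>l i\<bar> * e" using ge[OF i, of x] x(2) by (intro mult_left_mono) auto
      finally show "l i * (y i - x i) \<le> \<bar>l i\<bar> * e" .
    qed
    also have "\<dots> \<le> \<Lambda> * e"
      unfolding sum_distrib_right[symmetric] using lip \<open>0 < e\<close> by (intro mult_right_mono) auto
    finally show "y \<in> ?H (t + \<Lambda> * e)" using x(1) y(1) by simp
  qed
  then have "measure Q (Linf_enlarge r e' (?H t)) \<le> measure Q (?H (t + \<Lambda> * e))"
    by (rule Q.finite_measure_mono) (simp only: sets H)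
  moreover have "measure P (?H t) \<le> measure Q (Linf_enlarge r e' (?H t)) + e'"
    using e'(1) H by blast
  ultimately show ?thesis using e'(2) by linarith
qed

lemma profile_measurable:
  "(\<lambda>\<pi>. \<lambda>j\<in>{1..r}. rpoly_eval f (coupling_point \<pi> (k j))) \<in> random_permutation n \<rightarrow>\<^sub>M Rn_borel r"
  by (auto simp: space_PiM)

lemma prob_space_profile: "prob_space (profile n r k f)"
  unfolding profile_def by (intro measure_pmf.prob_space_distr profile_measurable)

lemma measure_profile_halfspace:
  "measure (profile n r k f) {y \<in> space (Rn_borel r). (\<Sum>i\<in>{1..r}. l i * y i) \<le> t} =
   measure_pmf.prob (random_permutation n)
     {\<pi>. (\<Sum>i\<in>{1..r}. l i * rpoly_eval f (coupling_point \<pi> (k i))) \<le> t}"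
  unfolding profile_def
  by (subst measure_distr[OF profile_measurable halfspace_in_sets])
    (auto simp: space_PiM intro!: arg_cong[where f = "measure_pmf.prob _"])

lemma prob_le_of_implies:
  assumes "\<And>\<pi>. P \<pi> \<Longrightarrow> Q \<pi> \<or> R \<pi>"
  shows "measure_pmf.prob D {\<pi>. P \<pi>} \<le> measure_pmf.prob D {\<pi>. Q \<pi>} + measure_pmf.prob D {\<pi>. R \<pi>}"
proof -
  have "measure_pmf.prob D {\<pi>. P \<pi>} \<le> measure_pmf.prob D ({\<pi>. Q \<pi>} \<union> {\<pi>. R \<pi>})"
    using assms by (intro measure_pmf.finite_measure_mono) auto
  also have "\<dots> \<le> measure_pmf.prob D {\<pi>. Q \<pi>} + measure_pmf.prob D {\<pi>. R \<pi>}"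
    by (rule measure_Un_le) auto
  finally show ?thesis .
qed

text \<open>
  Three replacements: \<open>f\<close> on slice \<open>s\<close> by its interpolation, the profile of \<open>f\<close> by that of \<open>g\<close>, and the
  interpolation of \<open>g\<close> by \<open>g\<close> on slice \<open>s\<close>.
\<close>

lemma slice_cdf_comparison:
  assumes lp: "levy_prokhorov_dist r (profile n r k f) (profile n r k g) < e" "1 \<le> r"
    and lip: "(\<Sum>i\<in>{1..r}. \<bar>l i\<bar>) \<le> \<Lambda>"
    and err: "\<And>h. h \<in> {f, g} \<Longrightarrow> measure_pmf.prob (random_permutation n)
      {\<pi>. \<delta> < \<bar>rpoly_eval h (coupling_point \<pi> s) - (\<Sum>i\<in>{1..r}. l i * rpoly_eval h (coupling_point \<pi> (k i)))\<bar>} \<le> \<delta>"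
  shows "measure_pmf.prob (random_permutation n) {\<pi>. rpoly_eval f (coupling_point \<pi> s) \<le> t} \<le>
    measure_pmf.prob (random_permutation n) {\<pi>. rpoly_eval g (coupling_point \<pi> s) \<le> t + (2 * \<delta> + \<Lambda> * e)}
    + (2 * \<delta> + e)"
proof -
  let ?p = "measure_pmf.prob (random_permutation n)"
  let ?a = "\<lambda>h \<pi>. rpoly_eval h (coupling_point \<pi> s)"
  let ?L = "\<lambda>h \<pi>. \<Sum>i\<in>{1..r}. l i * rpoly_eval h (coupling_point \<pi> (k i))"
  have "?p {\<pi>. ?a f \<pi> \<le> t} \<le> ?p {\<pi>. ?L f \<pi> \<le> t + \<delta>} + ?p {\<pi>. \<delta> < \<bar>?a f \<pi> - ?L f \<pi>\<bar>}"
    by (rule prob_le_of_implies) linarith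
  moreover have "?p {\<pi>. ?L f \<pi> \<le> t + \<delta>} \<le> ?p {\<pi>. ?L g \<pi> \<le> t + \<delta> + \<Lambda> * e} + e"
    using levy_prokhorov_halfspace[OF prob_space_profile prob_space_profile _ _ lp(2,1) lip, of "t + \<delta>"]
    unfolding measure_profile_halfspace by (simp add: profile_def)
  moreover have "?p {\<pi>. ?L g \<pi> \<le> t + \<delta> + \<Lambda> * e} \<le>
      ?p {\<pi>. ?a g \<pi> \<le> t + (2 * \<delta> + \<Lambda> * e)} + ?p {\<pi>. \<delta> < \<bar>?a g \<pi> - ?L g \<pi>\<bar>}"
    by (rule prob_le_of_implies) linarith
  moreover have "?p {\<pi>. \<delta> < \<bar>?a f \<pi> - ?L f \<pi>\<bar>} \<le> \<delta>" "?p {\<pi>. \<delta> < \<bar>?a g \<pi> - ?L g \<pi>\<bar>} \<le> \<delta>"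
    using err[of f] err[of g] by simp_all
  ultimately show ?thesis by linarith
qed

lemma cdf_mu: "cdf (distr (mu n p) borel (rpoly_eval f)) t = measure_pmf.prob (mu n p) {x. rpoly_eval f x \<le> t}"
  unfolding cdf_def by (subst measure_distr) (auto intro!: arg_cong[where f = "measure_pmf.prob _"])

text \<open>
  Averaging slice-wise comparisons over the binomial weights; a slice outside \<open>S\<close> contributes at most
  its weight.
\<close>

lemma mu_cdf_comparison:
  assumes "0 < p" "p < 1" "0 \<le> a"
    and good: "\<And>s t. s \<in> S \<Longrightarrow> s \<le> n \<Longrightarrow>
      measure_pmf.prob (random_permutation n) {\<pi>. rpoly_eval f (coupling_point \<pi> s) \<le> t} \<le>
      measure_pmf.prob (random_permutation n) {\<pi>. rpoly_eval g (coupling_point \<pi> s) \<le> t + b} + a"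
    and bad: "measure_pmf.prob (binomial_pmf n p) (- S) \<le> a'"
    and "b \<le> e" "a + a' \<le> e"
  shows "cdf (distr (mu n p) borel (rpoly_eval f)) t \<le> cdf (distr (mu n p) borel (rpoly_eval g)) (t + e) + e"
proof -
  let ?B = "binomial_pmf n p"
  let ?p = "measure_pmf.prob (random_permutation n)"
  let ?F = "\<lambda>s. ?p {\<pi>. rpoly_eval f (coupling_point \<pi> s) \<le> t}"
  let ?G = "\<lambda>s. ?p {\<pi>. rpoly_eval g (coupling_point \<pi> s) \<le> t + e}"
  have fin: "set_pmf ?B = {..n}" using assms by simp
  have int: "integrable (measure_pmf ?B) h" for h :: "nat \<Rightarrow> real"
    by (rule integrable_measure_pmf_finite) (simp add: fin)
  have "measure_pmf.expectation ?B ?F \<le> measure_pmf.expectation ?B (\<lambda>s. ?G s + (a + indicator (- S) s))"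
  proof (rule integral_mono_AE[OF int int])
    show "AE s in ?B. ?F s \<le> ?G s + (a + indicator (- S) s)"
      unfolding AE_measure_pmf_iff fin
    proof
      fix s assume s: "s \<in> {..n}"
      show "?F s \<le> ?G s + (a + indicator (- S) s)"
      proof (cases "s \<in> S")
        case True
        have "?p {\<pi>. rpoly_eval g (coupling_point \<pi> s) \<le> t + b} \<le> ?G s"
          using \<open>b \<le> e\<close> by (intro measure_pmf.finite_measure_mono) auto
        then show ?thesis using good[OF True, of t] s True by simp
      next
        case False
        have "?F s \<le> 1" by simp
        then show ?thesis using False \<open>0 \<le> a\<close> measure_nonneg[of "random_permutation n"]
          by (simp add: add_increasing)
      qed
    qed
  qed
  also have "\<dots> = measure_pmf.expectation ?B ?G + (a + measure_pmf.prob ?B (- S))"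
    by (simp add: int)
  also have "\<dots> \<le> measure_pmf.expectation ?B ?G + e" using bad \<open>a + a' \<le> e\<close> by simp
  finally show ?thesis
    unfolding cdf_mu prob_mu_mixture[OF assms(1,2)] by simp
qed

section \<open>Quantitative bounds\<close>

lemma lagrange_basis_sum_le:
  assumes "finite I" "card I = d + 1" "0 < b" "0 \<le> a"
    and near: "\<And>j. j \<in> I \<Longrightarrow> \<bar>t - x j\<bar> \<le> a"
    and apart: "\<And>i j. i \<in> I \<Longrightarrow> j \<in> I \<Longrightarrow> i \<noteq> j \<Longrightarrow> b \<le> \<bar>x i - x j\<bar>"
  shows "(\<Sum>i\<in>I. \<bar>lagrange_basis x I i t\<bar>) \<le> (2 * a / b) ^ d"
proof -
  have "\<bar>lagrange_basis x I i t\<bar> \<le> (a / b) ^ d" if i: "i \<in> I" for i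
  proof -
    have "\<bar>lagrange_basis x I i t\<bar> = (\<Prod>j\<in>I - {i}. \<bar>t - x j\<bar> / \<bar>x i - x j\<bar>)"
      by (simp add: lagrange_basis_def abs_prod)
    also have "\<dots> \<le> (\<Prod>j\<in>I - {i}. a / b)"
      using near apart[OF i] assms(3,4) by (intro prod_mono) (auto intro!: frac_le)
    also have "\<dots> = (a / b) ^ d" using assms(1,2) i by simp
    finally show ?thesis .
  qed
  then have "(\<Sum>i\<in>I. \<bar>lagrange_basis x I i t\<bar>) \<le> (\<Sum>i\<in>I. (a / b) ^ d)" by (rule sum_mono)
  also have "\<dots> = real (d + 1) * (a / b) ^ d" using assms(2) by simp
  also have "\<dots> \<le> 2 ^ d * (a / b) ^ d"
  proof (rule mult_right_mono)
    have "d + 1 \<le> 2 ^ d" using less_exp[of d] by (simp add: Suc_le_eq)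
    then show "real (d + 1) \<le> 2 ^ d" by (metis of_nat_le_iff of_nat_numeral of_nat_power)
  qed (use assms in simp)
  also have "\<dots> = (2 * a / b) ^ d" by (simp add: power_mult_distrib power_divide)
  finally show ?thesis .
qed

text \<open>
  The prefix size \<open>u\<close> for conditioning is the top of the window \<open>|s - np| \<le> \<tau> w\<close>, where \<open>w\<close> is the
  standard deviation. In the window \<open>s\<close> and \<open>n - s\<close> are at least half of \<open>np\<close> and \<open>n (1 - p)\<close>, so one
  step loses at most the fraction \<open>2 d / (np) + 2 d / (n (1 - p)) = 2 d / w\<^sup>2\<close>, and there are at most
  \<open>2 \<tau> w\<close> steps.
\<close>

lemma rpoly_interpolation_error:
  fixes p w \<tau> :: real and n d s :: nat
  assumes p: "0 < p" "p < 1" and w: "w\<^sup>2 = real n * p * (1 - p)" "0 < w"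
    and d: "1 \<le> d" and \<tau>: "1 \<le> \<tau>" "8 * \<tau> * real d \<le> w"
    and f: "multilinear f" "rpoly_degree f \<le> d"
    and I: "finite I" "card I = d + 1" "inj_on k I"
    and k: "\<And>i. i \<in> I \<Longrightarrow> \<bar>real (k i) - real n * p\<bar> \<le> \<tau> * w"
    and s: "\<bar>real s - real n * p\<bar> \<le> \<tau> * w"
    and norm: "\<And>i. i \<in> I \<Longrightarrow> L2_norm_pmf (nu n (k i)) (rpoly_eval f) \<le> 1"
    and lip: "(\<Sum>i\<in>I. \<bar>lagrange_basis (\<lambda>i. real (k i)) I i (real s)\<bar>) \<le> \<Lambda>"
  shows "perm_mean n (\<lambda>\<pi>. (rpoly_eval f (coupling_point \<pi> s) -
    (\<Sum>i\<in>I. lagrange_basis (\<lambda>i. real (k i)) I i (real s) * rpoly_eval f (coupling_point \<pi> (k i))))\<^sup>2)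
    \<le> 6 * (4 * \<tau> * real d / w) * \<Lambda>\<^sup>2"
proof -
  let ?c = "rpoly_coeff f"
  define V where "V = real n * p * (1 - p)"
  define u where "u = nat \<lfloor>real n * p + \<tau> * w\<rfloor>"
  have td: "\<tau> \<le> \<tau> * real d" "real d \<le> \<tau> * real d" using \<tau>(1) d by auto
  have w8: "8 * \<tau> \<le> w" "8 * real d \<le> w" "8 \<le> w" using td \<tau> by linarith+
  have V: "V = w * w" using w(1) by (simp add: V_def power2_eq_square)
  have Vpos: "0 < V" using w(2) V by simp
  have n: "0 < n" using Vpos p by (cases "n = 0") (auto simp: V_def)
  have tw: "8 * (\<tau> * w) \<le> V" using mult_right_mono[OF w8(1), of w] w(2) V by simp
  have dV: "64 * real d \<le> V"
    using mult_mono[OF w8(2) w8(3)] w(2) V by simp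
  have Vp: "V \<le> real n * p" "V \<le> real n * (1 - p)"
    using p mult_left_le[of "1 - p" "real n * p"] mult_left_le[of p "real n * (1 - p)"]
    by (auto simp: V_def mult_ac)
  have upper: "real u \<le> real n * p + \<tau> * w"
  proof -
    have "0 \<le> real n * p + \<tau> * w" using p w(2) \<tau>(1) by simp
    then show ?thesis unfolding u_def by linarith
  qed
  have le_u: "z \<le> u" if "\<bar>real z - real n * p\<bar> \<le> \<tau> * w" for z
    unfolding u_def using that by linarith
  have un: "real u \<le> real n - real n * (1 - p) / 2"
  proof -
    have "real n - real n * (1 - p) / 2 = real n * p + real n * (1 - p) / 2"
      by (simp add: field_simps)
    then show ?thesis using upper tw Vp(2) Vpos by linarith
  qed
  have "u \<le> n" using un p by (smt (verit) of_nat_le_iff mult_nonneg_nonneg of_nat_0_le_iff divide_nonneg_nonneg)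
  let ?\<kappa> = "2 * real d / V"
  let ?\<beta> = "4 * \<tau> * real d / w"
  have loss: "slice_inner n u (shrink_coeff z u ?c) (shrink_coeff z u ?c) \<ge> (1 - ?\<beta>) * slice_inner n z ?c ?c"
    if z: "\<bar>real z - real n * p\<bar> \<le> \<tau> * w" for z
  proof -
    have zl: "real n * p / 2 \<le> real z" using z tw Vp Vpos by linarith
    have "(1 - ?\<beta>) * slice_inner n z ?c ?c \<le> (1 - real (u - z) * ?\<kappa>) * slice_inner n z ?c ?c"
    proof (intro mult_right_mono slice_inner_nonneg diff_left_mono)
      have "real (u - z) \<le> 2 * (\<tau> * w)" using upper z le_u[OF z] by (simp add: of_nat_diff)
      then have "real (u - z) * ?\<kappa> \<le> 2 * (\<tau> * w) * ?\<kappa>" using Vpos by (intro mult_right_mono) auto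
      also have "\<dots> = ?\<beta>" using w(2) by (simp add: V)
      finally show "real (u - z) * ?\<kappa> \<le> ?\<beta>" .
    qed
    also have "\<dots> \<le> slice_inner n u (shrink_coeff z u ?c) (shrink_coeff z u ?c)"
    proof (rule shrink_norm_ge[OF le_u[OF z] \<open>u \<le> n\<close> degree_le_rpoly_coeff[OF f]])
      show "?\<kappa> \<le> 1" using dV Vpos by (simp add: field_simps)
      fix y assume y: "z \<le> y" "y < u"
      have 1: "real n * p / 2 \<le> real (Suc y)" using zl y by simp
      have 2: "real n * (1 - p) / 2 \<le> real (n - y)" using un y \<open>u \<le> n\<close> by (simp add: of_nat_diff)
      have "real d / real (Suc y) + real d / real (n - y) \<le>
          real d / (real n * p / 2) + real d / (real n * (1 - p) / 2)"
        using 1 2 p n y \<open>u \<le> n\<close> by (intro add_mono divide_left_mono) (auto intro!: mult_pos_pos)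
      also have "\<dots> = ?\<kappa>" using p n by (simp add: V_def field_simps)
      finally have 3: "real d / real (Suc y) + real d / real (n - y) \<le> ?\<kappa>" .
      have "real d \<le> real (Suc y)" "real d \<le> real (n - y)" using 1 2 dV Vp by linarith+
      then show "d \<le> Suc y \<and> d \<le> n - y \<and> real d / real (Suc y) + real d / real (n - y) \<le> ?\<kappa>"
        using 3 by (simp only: of_nat_le_iff)
    qed
    finally show ?thesis .
  qed
  show ?thesis
    unfolding rpoly_eval_coupling_point[OF f(1)]
  proof (rule interpolation_error[OF I(1,3) degree_le_rpoly_coeff[OF f] _ \<open>u \<le> n\<close> le_u[OF s] le_u[OF k] _ lip])
    show "d < card I" using I(2) by simp
    show "slice_inner n (k i) ?c ?c \<le> 1" if "i \<in> I" for i
      using le_u[OF k[OF that]] \<open>u \<le> n\<close> by (intro L2_norm_slice f norm that) simp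
    show "0 \<le> ?\<beta>" using \<tau> w(2) by simp
    show "?\<beta> \<le> 1 / 2" using \<tau>(2) w(2) by (simp add: field_simps)
    show "(1 - ?\<beta>) * slice_inner n z ?c ?c \<le>
        slice_inner n u (shrink_coeff z u ?c) (shrink_coeff z u ?c)" if "z = s \<or> z \<in> k ` I" for z
      using that s k by (intro loss) auto
  qed
qed

text \<open>
  With mean-square error \<open>B = 24 \<tau> d \<Lambda>\<^sup>2 / w\<close>, Markov's inequality gives probability at most \<open>\<delta>\<close> for an
  error above \<open>\<delta>\<close> as soon as \<open>\<delta>\<^sup>3 \<ge> B\<close>. Using \<open>\<tau> \<le> \<Lambda>\<close>, the choice \<open>\<delta> = 3 d \<Lambda> w\<^sup>-\<^sup>1\<^sup>/\<^sup>3\<close> suffices.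
  The hypothesis on the profiles is strict and has \<open>2 \<epsilon>\<close> so that it covers a distance equal to \<open>\<epsilon>\<close>.
\<close>

lemma levy_dist_profile_bound:
  fixes p w \<tau> \<eta> \<epsilon> :: real and n d :: nat
  assumes p: "0 < p" "p < 1" and w: "w\<^sup>2 = real n * p * (1 - p)" "0 < w"
    and d: "1 \<le> d" and \<tau>: "1 \<le> \<tau>" "8 * \<tau> * real d \<le> w"
    and \<eta>: "0 < \<eta>" "\<eta> \<le> 1"
    and k: "\<And>i. i \<in> {1..d + 1} \<Longrightarrow> \<bar>real (k i) - real n * p\<bar> \<le> \<tau> * w"
    and apart: "\<And>i j. i \<in> {1..d + 1} \<Longrightarrow> j \<in> {1..d + 1} \<Longrightarrow> i \<noteq> j \<Longrightarrow> \<eta> * w \<le> \<bar>real (k i) - real (k j)\<bar>"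
    and poly: "\<And>h. h \<in> {f, g} \<Longrightarrow> multilinear h \<and> rpoly_degree h \<le> d"
    and norm: "\<And>h i. h \<in> {f, g} \<Longrightarrow> i \<in> {1..d + 1} \<Longrightarrow> L2_norm_pmf (nu n (k i)) (rpoly_eval h) \<le> 1"
    and lp: "levy_prokhorov_dist (d + 1) (profile n (d + 1) k f) (profile n (d + 1) k g) < 2 * \<epsilon>"
    and tail: "2 * exp (- 2 * \<tau>\<^sup>2 * (p * (1 - p))) \<le> \<epsilon>"
  shows "levy_dist (distr (mu n p) borel (rpoly_eval f)) (distr (mu n p) borel (rpoly_eval g))
    \<le> 6 * real d * (4 * \<tau> / \<eta>) ^ d * w powr (- 1 / 3) + 3 * (4 * \<tau> / \<eta>) ^ d * \<epsilon>"
proof -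
  define \<Lambda> where "\<Lambda> = (4 * \<tau> / \<eta>) ^ d"
  define \<delta> where "\<delta> = 3 * real d * \<Lambda> * w powr (- 1 / 3)"
  have n: "0 < n" using w p by (cases "n = 0") auto
  have \<epsilon>: "0 < \<epsilon>" using tail by (smt (verit) exp_gt_zero)
  have "\<tau> \<le> 4 * \<tau> / \<eta>"
    using \<tau>(1) \<eta> by (simp add: pos_le_divide_eq mult_left_le order.trans[of "\<tau> * \<eta>" \<tau>])
  moreover have "4 * \<tau> / \<eta> \<le> \<Lambda>"
    unfolding \<Lambda>_def using calculation \<tau>(1) d by (intro self_le_power) auto
  ultimately have \<Lambda>: "\<tau> \<le> \<Lambda>" "1 \<le> \<Lambda>" using \<tau>(1) by auto
  have \<delta>: "0 < \<delta>" using d \<Lambda> w(2) by (simp add: \<delta>_def)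
  let ?S = "{s. \<bar>real s - real n * p\<bar> < \<tau> * w}"
  have inj: "inj_on k {1..d + 1}"
  proof (rule inj_onI, rule ccontr)
    fix i j assume "i \<in> {1..d + 1}" "j \<in> {1..d + 1}" "k i = k j" "i \<noteq> j"
    then show False using apart[of i j] mult_pos_pos[OF \<eta>(1) w(2)] by simp
  qed
  have lip: "(\<Sum>i\<in>{1..d + 1}. \<bar>lagrange_basis (\<lambda>i. real (k i)) {1..d + 1} i (real s)\<bar>) \<le> \<Lambda>"
    if "s \<in> ?S" for s
  proof -
    have "(\<Sum>i\<in>{1..d + 1}. \<bar>lagrange_basis (\<lambda>i. real (k i)) {1..d + 1} i (real s)\<bar>) \<le>
        (2 * (2 * (\<tau> * w)) / (\<eta> * w)) ^ d"
    proof (rule lagrange_basis_sum_le)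
      fix j assume "j \<in> {1..d + 1}"
      then show "\<bar>real s - real (k j)\<bar> \<le> 2 * (\<tau> * w)" using k[of j] that by simp
    qed (use apart \<eta> w \<tau> in auto)
    also have "2 * (2 * (\<tau> * w)) / (\<eta> * w) = 4 * \<tau> / \<eta>" using w(2) by simp
    finally show ?thesis by (simp add: \<Lambda>_def)
  qed
  have err: "measure_pmf.prob (random_permutation n)
      {\<pi>. \<delta> < \<bar>rpoly_eval h (coupling_point \<pi> s) - (\<Sum>i\<in>{1..d + 1}.
        lagrange_basis (\<lambda>i. real (k i)) {1..d + 1} i (real s) * rpoly_eval h (coupling_point \<pi> (k i)))\<bar>} \<le> \<delta>"
    if s: "s \<in> ?S" and h: "h \<in> {f, g}" for s h
  proof -
    have "perm_mean n (\<lambda>\<pi>. (rpoly_eval h (coupling_point \<pi> s) - (\<Sum>i\<in>{1..d + 1}.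
        lagrange_basis (\<lambda>i. real (k i)) {1..d + 1} i (real s) * rpoly_eval h (coupling_point \<pi> (k i))))\<^sup>2)
        \<le> 6 * (4 * \<tau> * real d / w) * \<Lambda>\<^sup>2"
    proof (rule rpoly_interpolation_error[OF p w d \<tau> _ _ _ _ inj k _ norm[OF h] lip[OF s]])
      show "multilinear h" "rpoly_degree h \<le> d" using poly[OF h] by auto
      show "\<bar>real s - real n * p\<bar> \<le> \<tau> * w" using s by simp
    qed simp_all
    also have "\<dots> \<le> \<delta> ^ 3"
    proof -
      have "(w powr (- 1 / 3)) ^ 3 = w powr (real 3 * (- 1 / 3))"
        using w(2) by (intro powr_power) simp
      also have "\<dots> = 1 / w" using w(2) by (simp add: powr_minus_divide)
      finally have "(w powr (- 1 / 3)) ^ 3 = 1 / w" .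
      then have "\<delta> ^ 3 = 27 * real d ^ 3 * \<Lambda> ^ 3 / w" by (simp add: \<delta>_def power_mult_distrib)
      moreover have "24 * \<tau> * real d * \<Lambda>\<^sup>2 \<le> 27 * real d ^ 3 * \<Lambda> ^ 3"
      proof -
        have "real d \<le> real d ^ 3" using d by (intro self_le_power) auto
        then have "(24 * \<tau>) * real d * \<Lambda>\<^sup>2 \<le> (27 * \<Lambda>) * real d ^ 3 * \<Lambda>\<^sup>2"
          using \<Lambda> \<tau>(1) by (intro mult_mono) auto
        then show ?thesis by (simp add: power3_eq_cube power2_eq_square mult_ac)
      qed
      ultimately show ?thesis using w(2) by (simp add: divide_right_mono)
    qed
    finally have "perm_mean n (\<lambda>\<pi>. (rpoly_eval h (coupling_point \<pi> s) - (\<Sum>i\<in>{1..d + 1}.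
        lagrange_basis (\<lambda>i. real (k i)) {1..d + 1} i (real s) * rpoly_eval h (coupling_point \<pi> (k i))))\<^sup>2)
        / \<delta>\<^sup>2 \<le> \<delta> ^ 3 / \<delta>\<^sup>2"
      by (intro divide_right_mono) auto
    also have "\<delta> ^ 3 / \<delta>\<^sup>2 = \<delta>" using \<delta> by (simp add: power3_eq_cube power2_eq_square)
    finally show ?thesis by (rule order.trans[OF markov_random_permutation[OF \<delta>]])
  qed
  have bad: "measure_pmf.prob (binomial_pmf n p) (- ?S) \<le> \<epsilon>"
  proof -
    have "- ?S = {x. \<tau> * w \<le> \<bar>real x - real n * p\<bar>}" by auto
    then have "measure_pmf.prob (binomial_pmf n p) (- ?S) \<le> 2 * exp (- 2 * (\<tau> * w)\<^sup>2 / real n)"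
      using binomial_distribution.prob_abs_ge[of p n "\<tau> * w"] p n w(2) \<tau>(1)
      by (simp add: binomial_distribution_def)
    also have "- 2 * (\<tau> * w)\<^sup>2 / real n = - 2 * \<tau>\<^sup>2 * (p * (1 - p))"
      unfolding power_mult_distrib w(1) using n by simp
    finally show ?thesis using tail by simp
  qed
  let ?e = "2 * \<delta> + 3 * \<Lambda> * \<epsilon>"
  have "\<epsilon> \<le> \<Lambda> * \<epsilon>" using mult_right_mono[OF \<Lambda>(2), of \<epsilon>] \<epsilon> by simp
  then have e: "2 * \<delta> + \<Lambda> * (2 * \<epsilon>) \<le> ?e" "(2 * \<delta> + 2 * \<epsilon>) + \<epsilon> \<le> ?e"
    using \<epsilon> by (simp_all add: algebra_simps)
  have compare: "cdf (distr (mu n p) borel (rpoly_eval h)) t \<le> cdf (distr (mu n p) borel (rpoly_eval h')) (t + ?e) + ?e"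
    if hh: "{h, h'} = {f, g}"
      and lp: "levy_prokhorov_dist (d + 1) (profile n (d + 1) k h) (profile n (d + 1) k h') < 2 * \<epsilon>" for h h' t
  proof (rule mu_cdf_comparison[OF p _ _ bad e])
    show "0 \<le> 2 * \<delta> + 2 * \<epsilon>" using \<delta> \<epsilon> by simp
    show "measure_pmf.prob (random_permutation n) {\<pi>. rpoly_eval h (coupling_point \<pi> s) \<le> t} \<le>
      measure_pmf.prob (random_permutation n)
        {\<pi>. rpoly_eval h' (coupling_point \<pi> s) \<le> t + (2 * \<delta> + \<Lambda> * (2 * \<epsilon>))} + (2 * \<delta> + 2 * \<epsilon>)"
      if "s \<in> ?S" for s t
      using err[OF that] by (intro slice_cdf_comparison[OF lp _ lip[OF that]]) (auto simp: hh)
  qed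
  have "levy_dist (distr (mu n p) borel (rpoly_eval f)) (distr (mu n p) borel (rpoly_eval g)) \<le> ?e"
    using lp by (intro levy_dist_le compare measure_pmf.prob_space_distr)
      (auto simp: levy_prokhorov_dist_commute)
  then show ?thesis by (simp add: \<delta>_def \<Lambda>_def)
qed

lemma levy_dist_mu_le_1:
  "levy_dist (distr (mu n p) borel (rpoly_eval f)) (distr (mu n p) borel (rpoly_eval g)) \<le> 1"
  by (rule levy_dist_le) (auto simp: cdf_mu intro!: measure_pmf.prob_space_distr add_increasing)

text \<open>
  The exponent is chosen such that the power \<open>d / 2\<close> of the right-hand side grows like \<open>V\<^sup>1\<^sup>/\<^sup>2\<^sup>4\<close>, the
  room between \<open>V\<^sup>-\<^sup>1\<^sup>/\<^sup>6\<close> and \<open>V\<^sup>-\<^sup>1\<^sup>/\<^sup>8\<close>.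
\<close>

lemma ln_le_root_power:
  fixes V :: real
  assumes "1 \<le> V" "1 \<le> d"
  shows "ln V \<le> 12 * real d * V powr (1 / (12 * real d))"
proof -
  have "ln V = 12 * real d * ln (V powr (1 / (12 * real d)))"
    using assms by (simp add: ln_powr)
  also have "\<dots> \<le> 12 * real d * V powr (1 / (12 * real d))"
  proof (rule mult_left_mono)
    have "ln (V powr (1 / (12 * real d))) \<le> V powr (1 / (12 * real d)) - 1"
      using assms by (intro ln_le_minus_one) simp
    then show "ln (V powr (1 / (12 * real d))) \<le> V powr (1 / (12 * real d))" by simp
  qed simp
  finally show ?thesis .
qed

lemma nat_le_two_power: "real d \<le> 2 ^ d"
  using less_exp[of d] by (metis less_imp_le of_nat_le_iff of_nat_numeral of_nat_power)

text \<open>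
  Here \<open>T\<close> is the bound of the theorem. Let \<open>\<Lambda> = (4 R \<surd>L)\<^sup>d\<close>. The key estimate is \<open>\<Lambda> \<le> (7 d R / q)\<^sup>d V\<^sup>1\<^sup>/\<^sup>2\<^sup>4\<close>, a consequence of
  \<open>\<epsilon>\<^sub>1 \<ge> V\<^sup>-\<^sup>1\<^sup>/\<^sup>4\<close>. The third conclusion covers the case that the standard deviation is too small for
  the window to be narrow, where \<open>T\<close> is a trivial bound; the fourth one treats the remaining case. The
  truncation is felt only if \<open>\<epsilon> < V\<^sup>-\<^sup>1\<^sup>/\<^sup>4\<close>, and then the term with \<open>\<epsilon>\<^sub>1\<close> is absorbed into the first
  summand of \<open>T\<close>.
\<close>

lemma error_terms_bound:
  fixes V q R \<epsilon> :: real
  assumes V: "81 \<le> V" and q: "0 < q" "q \<le> 1 / 4" and R: "1 \<le> R" and d: "1 \<le> d"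
    and \<epsilon>: "0 < \<epsilon>" "\<epsilon> \<le> 1 / 2"
  defines "\<epsilon>\<^sub>1 \<equiv> max \<epsilon> (V powr (- 1 / 4))"
  defines "L \<equiv> ln (1 / \<epsilon>\<^sub>1) / q"
  defines "T \<equiv> (200 * (real d / q) * R) powr (200 * real d) * V powr (- 1 / 8)
      + (200 * sqrt (ln (1 / \<epsilon>) / q) * R) ^ d * \<epsilon>"
  shows "\<epsilon>\<^sub>1 \<le> 1 / 2" "1 \<le> L"
    and "V powr (1 / 2) < 8 * (4 * R * sqrt L) ^ d * real d \<Longrightarrow> 1 \<le> T"
    and "6 * real d * (4 * R * sqrt L) ^ d * V powr (- 1 / 6) + 3 * (4 * R * sqrt L) ^ d * \<epsilon>\<^sub>1 \<le> T"
proof -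
  define Y where "Y = real d / q * R"
  define \<Lambda> where "\<Lambda> = (4 * R * sqrt L) ^ d"
  have dq: "1 \<le> real d / q" using q d by (simp add: field_simps)
  have Y: "1 \<le> Y" unfolding Y_def using mult_mono[OF dq R] dq by simp
  have "V powr (- 1 / 4) \<le> 16 powr (- 1 / 4)" using V by (intro powr_mono2') auto
  also have "(16::real) powr (- 1 / 4) = 1 / 2"
  proof -
    have "(16::real) powr (- 1 / 4) = (2 powr 4) powr (- 1 / 4)" by simp
    also have "\<dots> = 1 / 2" by (simp only: powr_powr) (simp add: powr_minus_divide)
    finally show ?thesis .
  qed
  finally show e1: "\<epsilon>\<^sub>1 \<le> 1 / 2" using \<epsilon>(2) by (simp add: \<epsilon>\<^sub>1_def)
  have e0: "0 < \<epsilon>\<^sub>1" using \<epsilon>(1) by (simp add: \<epsilon>\<^sub>1_def)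
  have "ln 2 \<le> ln (1 / \<epsilon>\<^sub>1)" using e0 e1 by (simp add: field_simps)
  moreover have "1 / 2 \<le> ln (2::real)" using ln2_ge_two_thirds by simp
  ultimately have l1: "1 / 2 \<le> ln (1 / \<epsilon>\<^sub>1)" by linarith
  then show L1: "1 \<le> L" using q by (simp add: L_def field_simps)
  have "ln (1 / \<epsilon>\<^sub>1) \<le> ln (V powr (1 / 4))"
  proof -
    have "V powr (- 1 / 4) \<le> \<epsilon>\<^sub>1" by (simp add: \<epsilon>\<^sub>1_def)
    then have "1 / \<epsilon>\<^sub>1 \<le> 1 / V powr (- 1 / 4)" using V by (intro divide_left_mono) (auto simp: e0)
    then have "1 / \<epsilon>\<^sub>1 \<le> V powr (1 / 4)" by (simp add: powr_minus_divide)
    then show ?thesis using e0 V by (subst ln_le_cancel_iff) auto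
  qed
  also have "\<dots> = ln V / 4" using V by (simp add: ln_powr)
  also have "\<dots> \<le> 3 * real d * V powr (1 / (12 * real d))"
    using ln_le_root_power[of V d] V d by simp
  finally have "L \<le> 3 * (real d / q) * V powr (1 / (12 * real d))"
    using q by (simp add: L_def divide_right_mono)
  also have "\<dots> \<le> (7 / 4 * (real d / q) * V powr (1 / (24 * real d)))\<^sup>2"
  proof -
    have "(V powr (1 / (24 * real d)))\<^sup>2 = V powr (1 / (12 * real d))"
      using V d by (simp add: powr_power)
    moreover have "3 * (real d / q) \<le> (7 / 4 * (real d / q))\<^sup>2"
      using mult_left_mono[OF dq, of "real d / q"] dq by (simp add: power2_eq_square)
    ultimately show ?thesis
      unfolding power_mult_distrib[of "7 / 4 * (real d / q)"] by (metis mult_right_mono powr_ge_zero)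
  qed
  finally have "sqrt L \<le> 7 / 4 * (real d / q) * V powr (1 / (24 * real d))"
    using q by (intro real_le_lsqrt) auto
  then have "4 * R * sqrt L \<le> 4 * R * (7 / 4 * (real d / q) * V powr (1 / (24 * real d)))"
    using R by (intro mult_left_mono) auto
  also have "\<dots> = 7 * Y * V powr (1 / (24 * real d))" by (simp add: Y_def)
  finally have "\<Lambda> \<le> (7 * Y * V powr (1 / (24 * real d))) ^ d"
    unfolding \<Lambda>_def using R L1 by (intro power_mono) auto
  also have "\<dots> = (7 * Y) ^ d * V powr (1 / 24)"
    using V d by (simp add: power_mult_distrib powr_power)
  finally have \<Lambda>: "\<Lambda> \<le> (7 * Y) ^ d * V powr (1 / 24)" .
  have \<Lambda>0: "0 \<le> \<Lambda>" using R L1 by (simp add: \<Lambda>_def)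
  have big: "(200 * Y) ^ d \<le> (200 * (real d / q) * R) powr (200 * real d)"
  proof -
    have "(200 * Y) ^ d = (200 * Y) powr real d" using Y by (simp add: powr_realpow)
    also have "\<dots> \<le> (200 * Y) powr (200 * real d)" using Y by (intro powr_mono) auto
    finally show ?thesis by (simp add: Y_def mult_ac)
  qed
  have T2: "0 \<le> (200 * sqrt (ln (1 / \<epsilon>) / q) * R) ^ d * \<epsilon>"
    using \<epsilon> q R by (intro mult_nonneg_nonneg zero_le_power) auto
  show "1 \<le> T" if "V powr (1 / 2) < 8 * (4 * R * sqrt L) ^ d * real d"
  proof -
    have "V powr (1 / 8) * V powr (1 / 24) \<le> V powr (1 / 2)"
      unfolding powr_add[symmetric] using V by (intro powr_mono) auto
    also have "\<dots> \<le> 8 * ((7 * Y) ^ d * V powr (1 / 24)) * 2 ^ d"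
      using that \<Lambda> \<Lambda>0 nat_le_two_power[of d] Y
      by (intro order.trans[OF less_imp_le[OF that]] mult_mono) (auto simp: \<Lambda>_def[symmetric])
    finally have "V powr (1 / 8) \<le> 8 * (7 * Y) ^ d * 2 ^ d"
      using V by (simp add: mult_ac)
    also have "\<dots> \<le> 8 ^ d * (7 * Y) ^ d * 2 ^ d"
      using Y d self_le_power[of "8::real" d] by (intro mult_right_mono) auto
    also have "\<dots> = (8 * (7 * Y) * 2) ^ d" by (simp only: power_mult_distrib)
    also have "\<dots> \<le> (200 * Y) ^ d" using Y by (intro power_mono) auto
    also note big
    finally have "V powr (1 / 8) * V powr (- 1 / 8) \<le>
        (200 * (real d / q) * R) powr (200 * real d) * V powr (- 1 / 8)"
      by (intro mult_right_mono) auto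
    moreover have "V powr (1 / 8) * V powr (- 1 / 8) = 1"
      unfolding powr_add[symmetric] using V by simp
    ultimately show ?thesis unfolding T_def using T2 by linarith
  qed
  have first: "\<Lambda> * V powr (- 1 / 6) \<le> (7 * Y) ^ d * V powr (- 1 / 8)"
  proof -
    have "\<Lambda> * V powr (- 1 / 6) \<le> (7 * Y) ^ d * V powr (1 / 24) * V powr (- 1 / 6)"
      using \<Lambda> by (intro mult_right_mono) auto
    also have "\<dots> = (7 * Y) ^ d * V powr (- 1 / 8)"
      by (simp add: mult.assoc powr_add[symmetric])
    finally show ?thesis .
  qed
  have "V powr (- 1 / 4) \<le> V powr (- 1 / 6)" using V by (intro powr_mono) auto
  then have "\<Lambda> * V powr (- 1 / 4) \<le> \<Lambda> * V powr (- 1 / 6)"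
    using \<Lambda>0 by (intro mult_left_mono) auto
  then have second: "\<Lambda> * V powr (- 1 / 4) \<le> (7 * Y) ^ d * V powr (- 1 / 8)" using first by linarith
  have "3 * \<Lambda> * \<epsilon>\<^sub>1 \<le> 3 * ((7 * Y) ^ d * V powr (- 1 / 8)) + (200 * sqrt (ln (1 / \<epsilon>) / q) * R) ^ d * \<epsilon>"
  proof (cases "V powr (- 1 / 4) \<le> \<epsilon>")
    case True
    then have "\<epsilon>\<^sub>1 = \<epsilon>" by (simp add: \<epsilon>\<^sub>1_def)
    have "3 * \<Lambda> * \<epsilon> \<le> 3 ^ d * \<Lambda> * \<epsilon>"
      using d self_le_power[of "3::real" d] R L1 \<epsilon>(1)
      by (intro mult_right_mono) (auto simp: \<Lambda>_def)
    also have "3 ^ d * \<Lambda> = (12 * sqrt (ln (1 / \<epsilon>) / q) * R) ^ d"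
      by (simp add: \<Lambda>_def L_def \<open>\<epsilon>\<^sub>1 = \<epsilon>\<close> power_mult_distrib[symmetric] mult_ac)
    also have "\<dots> * \<epsilon> \<le> (200 * sqrt (ln (1 / \<epsilon>) / q) * R) ^ d * \<epsilon>"
      using \<epsilon> q R by (intro mult_right_mono power_mono) auto
    finally show ?thesis using \<open>\<epsilon>\<^sub>1 = \<epsilon>\<close> Y by (simp add: add_increasing)
  next
    case False
    then show ?thesis using second T2 by (simp add: \<epsilon>\<^sub>1_def)
  qed
  moreover have "6 * real d * \<Lambda> * V powr (- 1 / 6) \<le> 6 * real d * ((7 * Y) ^ d * V powr (- 1 / 8))"
    using mult_left_mono[OF first, of "6 * real d"] by (simp add: mult_ac)
  moreover have "6 * real d * ((7 * Y) ^ d * V powr (- 1 / 8)) + 3 * ((7 * Y) ^ d * V powr (- 1 / 8))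
      \<le> (200 * (real d / q) * R) powr (200 * real d) * V powr (- 1 / 8)"
  proof -
    have "6 * real d + 3 \<le> 9 * real d" using d by simp
    also have "\<dots> \<le> 9 ^ d * 2 ^ d"
      using d self_le_power[of "9::real" d] nat_le_two_power[of d] by (intro mult_mono) auto
    finally have "(6 * real d + 3) * (7 * Y) ^ d \<le> 9 ^ d * 2 ^ d * (7 * Y) ^ d"
      using Y by (intro mult_right_mono) auto
    also have "\<dots> = (9 * 2 * (7 * Y)) ^ d" by (simp only: power_mult_distrib)
    also have "\<dots> \<le> (200 * Y) ^ d" using Y by (intro power_mono) auto
    also note big
    finally have "(6 * real d + 3) * (7 * Y) ^ d * V powr (- 1 / 8)
        \<le> (200 * (real d / q) * R) powr (200 * real d) * V powr (- 1 / 8)"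
      by (rule mult_right_mono) simp
    then show ?thesis by (simp only: distrib_right mult.assoc)
  qed
  ultimately show "6 * real d * (4 * R * sqrt L) ^ d * V powr (- 1 / 6)
      + 3 * (4 * R * sqrt L) ^ d * \<epsilon>\<^sub>1 \<le> T"
    unfolding T_def \<Lambda>_def[symmetric] by linarith
qed

theorem corollary6p19:
  shows "\<exists>K C :: real. K > 0 \<and> C > 0 \<and>
    (\<forall>(p::real) (n::nat) (d::nat) (k :: nat \<Rightarrow> nat) (\<eta>::real) (M::real)
       (f::rpoly) (g::rpoly) (\<epsilon>::real).
      0 < p \<longrightarrow> p < 1 \<longrightarrow>
      1 \<le> d \<longrightarrow>
      real d \<le> K * sqrt (real n * p * (1 - p) / ln (real n * p * (1 - p))) \<longrightarrow>
      slice_system p n \<eta> M (d + 1) k \<longrightarrow>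
      M \<le> sqrt (real n * p * (1 - p)) / (9 * real d) \<longrightarrow>
      rpoly_in_vars {1..n} f \<longrightarrow> multilinear f \<longrightarrow> rpoly_degree f = d \<longrightarrow>
      rpoly_in_vars {1..n} g \<longrightarrow> multilinear g \<longrightarrow> rpoly_degree g = d \<longrightarrow>
      (\<forall>i\<in>{1..d + 1}. L2_norm_pmf (nu n (k i)) (rpoly_eval f) \<le> 1) \<longrightarrow>
      (\<forall>i\<in>{1..d + 1}. L2_norm_pmf (nu n (k i)) (rpoly_eval g) \<le> 1) \<longrightarrow>
      levy_prokhorov_dist (d + 1) (profile n (d + 1) k f) (profile n (d + 1) k g) = \<epsilon> \<longrightarrow>
      0 < \<epsilon> \<longrightarrow> \<epsilon> \<le> 1 / 2 \<longrightarrow>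
      levy_dist (distr (mu n p) borel (rpoly_eval f)) (distr (mu n p) borel (rpoly_eval g))
        \<le> (C * (real d / (p * (1 - p))) * (M / \<eta>)) powr (C * real d)
              * (1 / root 8 (real n * p * (1 - p)))
          + (C * sqrt (ln (1 / \<epsilon>) / (p * (1 - p))) * (M / \<eta>)) ^ d * \<epsilon>)"
proof (rule exI[of _ 1], rule exI[of _ 200], intro conjI allI impI)
  fix p :: real and n d :: nat and k :: "nat \<Rightarrow> nat" and \<eta> M :: real and f g :: rpoly and \<epsilon> :: real
  assume p: "0 < p" "p < 1" and d: "1 \<le> d"
    and sys: "slice_system p n \<eta> M (d + 1) k"
    and M_le: "M \<le> sqrt (real n * p * (1 - p)) / (9 * real d)"
    and f: "multilinear f" "rpoly_degree f = d" and g: "multilinear g" "rpoly_degree g = d"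
    and norm_f: "\<forall>i\<in>{1..d + 1}. L2_norm_pmf (nu n (k i)) (rpoly_eval f) \<le> 1"
    and norm_g: "\<forall>i\<in>{1..d + 1}. L2_norm_pmf (nu n (k i)) (rpoly_eval g) \<le> 1"
    and lp: "levy_prokhorov_dist (d + 1) (profile n (d + 1) k f) (profile n (d + 1) k g) = \<epsilon>"
    and \<epsilon>: "0 < \<epsilon>" "\<epsilon> \<le> 1 / 2"
  define V where "V = real n * p * (1 - p)"
  define q where "q = p * (1 - p)"
  define w where "w = sqrt V"
  define R where "R = M / \<eta>"
  have \<eta>: "0 < \<eta>" "\<eta> \<le> 1" and M: "1 \<le> M" using sys by (auto simp: slice_system_def)
  have "1 \<le> w / (9 * real d)" using M M_le by (simp add: w_def V_def)
  then have "9 * real d \<le> w" using d by (simp add: field_simps)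
  then have w9: "9 \<le> w" using d by simp
  then have w: "0 < w" by simp
  then have w2: "w\<^sup>2 = V" by (simp add: w_def)
  have V: "81 \<le> V" using power_mono[OF w9, of 2] w2 by simp
  have q: "0 < q" "q \<le> 1 / 4"
  proof -
    show "0 < q" using p by (simp add: q_def)
    have "0 \<le> (p - 1 / 2)\<^sup>2" by simp
    then show "q \<le> 1 / 4" by (simp add: q_def power2_eq_square algebra_simps)
  qed
  have R: "1 \<le> R" using \<eta> M by (simp add: R_def)
  define \<epsilon>\<^sub>1 where "\<epsilon>\<^sub>1 = max \<epsilon> (V powr (- 1 / 4))"
  define L where "L = ln (1 / \<epsilon>\<^sub>1) / q"
  define \<tau> where "\<tau> = M * sqrt L"
  define T where "T = (200 * (real d / q) * R) powr (200 * real d) * V powr (- 1 / 8)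
      + (200 * sqrt (ln (1 / \<epsilon>) / q) * R) ^ d * \<epsilon>"
  note bounds = error_terms_bound[OF V q R d \<epsilon>, folded \<epsilon>\<^sub>1_def, folded L_def, folded T_def]
  have e0: "0 < \<epsilon>\<^sub>1" using \<epsilon>(1) by (simp add: \<epsilon>\<^sub>1_def)
  have base: "4 * \<tau> / \<eta> = 4 * R * sqrt L" by (simp add: \<tau>_def R_def)
  \<comment> \<open>\<open>\<tau> \<ge> M\<close> puts all nodes into the window, since \<open>L \<ge> 1\<close>.\<close>
  have "1 \<le> sqrt L" using bounds(2) by simp
  then have \<tau>: "M \<le> \<tau>" using M by (simp add: \<tau>_def)
  then have \<tau>1: "1 \<le> \<tau>" using M by simp
  have "levy_dist (distr (mu n p) borel (rpoly_eval f)) (distr (mu n p) borel (rpoly_eval g)) \<le> T"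
  proof (cases "8 * \<tau> * real d \<le> w")
    case True
    have "levy_dist (distr (mu n p) borel (rpoly_eval f)) (distr (mu n p) borel (rpoly_eval g))
      \<le> 6 * real d * (4 * \<tau> / \<eta>) ^ d * w powr (- 1 / 3) + 3 * (4 * \<tau> / \<eta>) ^ d * \<epsilon>\<^sub>1"
    proof (rule levy_dist_profile_bound[OF p _ w d \<tau>1 True \<eta>])
      show "w\<^sup>2 = real n * p * (1 - p)" using w2 by (simp add: V_def)
      show "\<bar>real (k i) - real n * p\<bar> \<le> \<tau> * w" if "i \<in> {1..d + 1}" for i
      proof -
        have "\<bar>real (k i) - real n * p\<bar> / w \<le> M"
          using sys that w by (auto simp: slice_system_def slice_sigma_def w_def V_def)
        then have "\<bar>real (k i) - real n * p\<bar> \<le> M * w" using w by (simp add: field_simps)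
        also have "\<dots> \<le> \<tau> * w" using \<tau> w by simp
        finally show ?thesis .
      qed
      show "\<eta> * w \<le> \<bar>real (k i) - real (k j)\<bar>"
        if "i \<in> {1..d + 1}" "j \<in> {1..d + 1}" "i \<noteq> j" for i j
      proof -
        have "\<eta> \<le> \<bar>(real (k i) - real n * p) / w - (real (k j) - real n * p) / w\<bar>"
          using sys that unfolding slice_system_def slice_sigma_def w_def V_def by blast
        also have "\<dots> = \<bar>real (k i) - real (k j)\<bar> / w"
          using w by (simp add: diff_divide_distrib[symmetric])
        finally show ?thesis using w by (simp add: field_simps)
      qed
      show "levy_prokhorov_dist (d + 1) (profile n (d + 1) k f) (profile n (d + 1) k g) < 2 * \<epsilon>\<^sub>1"
        using lp \<epsilon> by (simp add: \<epsilon>\<^sub>1_def)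
      show "2 * exp (- 2 * \<tau>\<^sup>2 * (p * (1 - p))) \<le> \<epsilon>\<^sub>1"
      proof -
        have "L * q = ln (1 / \<epsilon>\<^sub>1)" using q by (simp add: L_def)
        moreover have "L * q \<le> \<tau>\<^sup>2 * q"
        proof -
          have "L = (sqrt L)\<^sup>2" using bounds(2) by simp
          also have "\<dots> \<le> \<tau>\<^sup>2"
            unfolding \<tau>_def using M bounds(2) by (intro power_mono) auto
          finally show ?thesis using q by simp
        qed
        moreover have "ln (1 / \<epsilon>\<^sub>1) = - ln \<epsilon>\<^sub>1" using e0 by (simp add: ln_div)
        moreover have "- 2 * \<tau>\<^sup>2 * q = - 2 * (\<tau>\<^sup>2 * q)" by (simp only: mult.assoc)
        \<comment> \<open>The tail is at most \<open>2 \<epsilon>\<^sub>1\<^sup>2\<close>, and one factor \<open>\<epsilon>\<^sub>1 \<le> 1 / 2\<close> pays for the \<open>2\<close>.\<close>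
        ultimately have "- 2 * \<tau>\<^sup>2 * q \<le> ln \<epsilon>\<^sub>1 + ln \<epsilon>\<^sub>1" by linarith
        then have "exp (- 2 * \<tau>\<^sup>2 * q) \<le> exp (ln \<epsilon>\<^sub>1 + ln \<epsilon>\<^sub>1)"
          by (simp only: exp_le_cancel_iff)
        also have "\<dots> = \<epsilon>\<^sub>1 * \<epsilon>\<^sub>1" by (simp only: exp_add exp_ln[OF e0])
        also have "\<dots> \<le> 1 / 2 * \<epsilon>\<^sub>1" using bounds(1) e0 by (intro mult_right_mono) auto
        finally show ?thesis by (simp add: q_def)
      qed
    qed (use f g norm_f norm_g in auto)
    also have "w powr (- 1 / 3) = V powr (- 1 / 6)"
      using V by (simp add: w_def powr_half_sqrt[symmetric] powr_powr)
    finally show ?thesis using bounds(4) unfolding base by linarith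
  next
    case False
    have "\<tau> \<le> 4 * \<tau> / \<eta>"
      using \<tau>1 \<eta> by (simp add: pos_le_divide_eq mult_left_le order.trans[of "\<tau> * \<eta>" \<tau>])
    also have "\<dots> \<le> (4 * \<tau> / \<eta>) ^ d" using calculation \<tau>1 d by (intro self_le_power) auto
    finally have "8 * \<tau> * real d \<le> 8 * (4 * R * sqrt L) ^ d * real d"
      unfolding base by (intro mult_right_mono mult_left_mono) auto
    then have "V powr (1 / 2) < 8 * (4 * R * sqrt L) ^ d * real d"
      using False V by (simp add: powr_half_sqrt w_def)
    from order.trans[OF levy_dist_mu_le_1 bounds(3)[OF this]] show ?thesis .
  qed
  moreover have "V powr (- 1 / 8) = 1 / root 8 V"
    using V by (simp add: root_powr_inverse powr_minus_divide)
  then have "T = (200 * (real d / (p * (1 - p))) * (M / \<eta>)) powr (200 * real d)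
              * (1 / root 8 (real n * p * (1 - p)))
          + (200 * sqrt (ln (1 / \<epsilon>) / (p * (1 - p))) * (M / \<eta>)) ^ d * \<epsilon>"
    by (simp add: T_def V_def q_def R_def)
  ultimately show "levy_dist (distr (mu n p) borel (rpoly_eval f)) (distr (mu n p) borel (rpoly_eval g))
        \<le> (200 * (real d / (p * (1 - p))) * (M / \<eta>)) powr (200 * real d)
              * (1 / root 8 (real n * p * (1 - p)))
          + (200 * sqrt (ln (1 / \<epsilon>) / (p * (1 - p))) * (M / \<eta>)) ^ d * \<epsilon>" by simp
qed simp_all

end
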